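(* There exist absolute constants $c, C>0$ such that for all integers $d\ge 1$, $n\ge 1$, and every graph $G$ with vertex set $\{1,\dots,d\}$ and $m$ edges, the following hold. (i) The minimax rate for learning, in total variation distance, the class $\mathcal{I}_G$ of $d$-dimensional Ising models with underlying graph $G$ satisfies $$c\min\left\{1,\sqrt{\frac{m+d}{n}}\right\}\le \mathcal{R}_n(\mathcal{I}_G)\le C\min\left\{1,\sqrt{\frac{m+d}{n}}\right\}.$$ (ii) The minimax rate for learning, in total variation distance, the subclass $\mathcal{I}'_G\subseteq\mathcal{I}_G$ of Ising models with no external magnetic field satisfies $$c\min\left\{1,\sqrt{\frac{m}{n}}\right\}\le \mathcal{R}_n(\mathcal{I}'_G)\le C\min\left\{1,\sqrt{\frac{m}{n}}\right\}.$$
   Context: All graphs are undirected, without parallel edges or self-loops. Ising models. Let $G=(\{1,\dots,d\},E)$ be a graph. An Ising model with underlying graph $G$, interactions $w_{ij}\in\mathbb{R}$ for $\{i,j\}\in E$, and external magnetic field $h=(h_1,\dots,h_d)\in\mathbb{R}^d$ is the probability mass function on $\{-1,1\}^d$ that assigns to $x\in\{-1,1\}^d$ probability proportional to $\exp\{\sum_{\{i,j\}\in E} w_{ij}x_ix_j+\sum_{i=1}^d h_i x_i\}$. $\mathcal{I}_G$ is the class of all such models (all real choices of $w_{ij}$, $h_i$), and $\mathcal{I}'_G$ is the subclass of those with no external magnetic field, i.e. $h_1=\dots=h_d=0$. Minimax risk. Let $\mathcal{F}$ be a class of probability mass functions on $\mathcal{X}=\{-1,1\}^d$. For functions $f,g:\mathcal{X}\to\mathbb{R}$,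 $\mathrm{TV}(f,g)=\frac12\|f-g\|_1=\frac12\sum_{x\in\mathcal{X}}|f(x)-g(x)|$. An estimator is a (possibly randomized) map $\hat f:\mathcal{X}^n\to\mathbb{R}^{\mathcal{X}}$ applied to i.i.d. samples $X_1,\dots,X_n$ from an unknown $f\in\mathcal{F}$. Its risk is $\mathcal{R}_n(\hat f,\mathcal{F})=\sup_{f\in\mathcal{F}}\mathbf{E}\{\mathrm{TV}(\hat f,f)\}$, the expectation being over the $n$ i.i.d. samples from $f$ and any randomization of the estimator. The minimax rate for learning $\mathcal{F}$ is $\mathcal{R}_n(\mathcal{F})=\inf_{\hat f}\mathcal{R}_n(\hat f,\mathcal{F})$. *)

theory Defs
  imports "HOL-Probability.Probability"
begin

section \<open>Graphs on the vertices 1, ..., d\<close>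

definition simple_graph :: "nat \<Rightarrow> nat set set \<Rightarrow> bool" where
  "simple_graph d E \<longleftrightarrow> E \<subseteq> {e. e \<subseteq> {1..d} \<and> card e = 2}"

section \<open>Ising models\<close>

text \<open>A point of the cube is a function on all of \<^typ>\<open>nat\<close> that is \<^const>\<open>undefined\<close> outside
  \<open>{1..d}\<close>, so that distinct functions are distinct points.\<close>

definition spin_cube :: "nat \<Rightarrow> (nat \<Rightarrow> real) set" where
  "spin_cube d = {1..d} \<rightarrow>\<^sub>E {-1, 1}"

text \<open>Interactions are indexed by edges. For an edge \<open>e = {i, j}\<close> with \<open>i \<noteq> j\<close>, the product over
  \<open>e\<close> is \<open>x i * x j\<close>. Values of \<open>w\<close> off the edge set and of \<open>h\<close> off \<open>{1..d}\<close> are irrelevant.\<close>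

definition ising_weight ::
    "nat \<Rightarrow> nat set set \<Rightarrow> (nat set \<Rightarrow> real) \<Rightarrow> (nat \<Rightarrow> real) \<Rightarrow> (nat \<Rightarrow> real) \<Rightarrow> real" where
  "ising_weight d E w h x = exp ((\<Sum>e\<in>E. w e * (\<Prod>i\<in>e. x i)) + (\<Sum>i=1..d. h i * x i))"

definition ising_pmf ::
    "nat \<Rightarrow> nat set set \<Rightarrow> (nat set \<Rightarrow> real) \<Rightarrow> (nat \<Rightarrow> real) \<Rightarrow> (nat \<Rightarrow> real) pmf" where
  "ising_pmf d E w h = embed_pmf (\<lambda>x. if x \<in> spin_cube d
     then ising_weight d E w h x / (\<Sum>y\<in>spin_cube d. ising_weight d E w h y) else 0)"

definition ising_class :: "nat \<Rightarrow> nat set set \<Rightarrow> (nat \<Rightarrow> real) pmf set" where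
  "ising_class d E = {ising_pmf d E w h |w h. True}"

definition ising_class_no_field :: "nat \<Rightarrow> nat set set \<Rightarrow> (nat \<Rightarrow> real) pmf set" where
  "ising_class_no_field d E = {ising_pmf d E w (\<lambda>_. 0) |w. True}"

lemma finite_spin_cube: "finite (spin_cube d)"
  unfolding spin_cube_def by (intro finite_PiE) auto

lemma spin_cube_nonempty: "spin_cube d \<noteq> {}"
  unfolding spin_cube_def by (simp add: PiE_eq_empty_iff)

lemma pmf_ising_pmf:
  "pmf (ising_pmf d E w h) x = (if x \<in> spin_cube d
     then ising_weight d E w h x / (\<Sum>y\<in>spin_cube d. ising_weight d E w h y) else 0)"
  unfolding ising_pmf_def
proof (rule pmf_embed_pmf)
  let ?Z = "\<Sum>y\<in>spin_cube d. ising_weight d E w h y"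
  let ?f = "\<lambda>x. if x \<in> spin_cube d then ising_weight d E w h x / ?Z else 0"
  have Z: "?Z > 0"
    by (intro sum_pos finite_spin_cube spin_cube_nonempty) (simp add: ising_weight_def)
  show nonneg: "0 \<le> ?f x" for x
    using Z by (simp add: ising_weight_def)
  have "(\<integral>\<^sup>+x. ennreal (?f x) \<partial>count_space UNIV) = (\<Sum>x\<in>spin_cube d. ennreal (?f x))"
    by (rule nn_integral_count_space') (auto simp: finite_spin_cube)
  also have "\<dots> = ennreal (\<Sum>x\<in>spin_cube d. ?f x)"
    by (rule sum_ennreal) (rule nonneg)
  also have "(\<Sum>x\<in>spin_cube d. ?f x) = 1"
    using Z by (simp flip: sum_divide_distrib)
  finally show "(\<integral>\<^sup>+x. ennreal (?f x) \<partial>count_space UNIV) = 1" by simp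
qed

lemma set_ising_pmf: "set_pmf (ising_pmf d E w h) = spin_cube d"
proof -
  have "(\<Sum>y\<in>spin_cube d. ising_weight d E w h y) > 0"
    by (intro sum_pos finite_spin_cube spin_cube_nonempty) (simp add: ising_weight_def)
  then show ?thesis
    by (auto simp: set_pmf_eq pmf_ising_pmf ising_weight_def)
qed

section \<open>Minimax risk in total variation distance\<close>

definition tv_dist :: "'a set \<Rightarrow> ('a \<Rightarrow> real) \<Rightarrow> ('a \<Rightarrow> real) \<Rightarrow> real" where
  "tv_dist X f g = (1 / 2) * (\<Sum>x\<in>X. \<bar>f x - g x\<bar>)"

text \<open>A randomized estimator is a Markov kernel: it sends each sample in \<open>X\<^sup>n\<close> to the
  law of its output, a random element of \<open>\<real>\<^sup>X\<close>. The output ranges over all real functions on \<open>X\<close>, not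
  only over probability mass functions. Deterministic estimators are the kernels of point masses.\<close>

definition estimators :: "'a set \<Rightarrow> nat \<Rightarrow> ('a list \<Rightarrow> ('a \<Rightarrow> real) measure) set" where
  "estimators X n =
     count_space {xs. set xs \<subseteq> X \<and> length xs = n} \<rightarrow>\<^sub>M prob_algebra (\<Pi>\<^sub>M x\<in>X. borel)"

text \<open>The risk takes values in \<^typ>\<open>ennreal\<close> because the expected loss may be infinite.\<close>

definition risk ::
    "'a set \<Rightarrow> nat \<Rightarrow> ('a list \<Rightarrow> ('a \<Rightarrow> real) measure) \<Rightarrow> 'a pmf set \<Rightarrow> ennreal" where
  "risk X n K F = (SUP f\<in>F. \<integral>\<^sup>+ xs. (\<integral>\<^sup>+ g. ennreal (tv_dist X g (pmf f)) \<partial>K xs)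
     \<partial>measure_pmf (replicate_pmf n f))"

definition minimax_rate :: "'a set \<Rightarrow> nat \<Rightarrow> 'a pmf set \<Rightarrow> ennreal" where
  "minimax_rate X n F = (INF K\<in>estimators X n. risk X n K F)"

lemma measurable_tv_dist:
  assumes "finite X"
  shows "(\<lambda>g. ennreal (tv_dist X g f)) \<in> borel_measurable (\<Pi>\<^sub>M x\<in>X. borel)"
  unfolding tv_dist_def by measurable

end

theory Submission
  imports Defs
begin

text \<open>
  Write \<open>\<chi>\<^sub>S(x)\<close> for the product of the spins \<open>x\<^sub>i\<close> with \<open>i \<in> S\<close>. A magnetic field at \<open>i\<close> is an
  interaction on the singleton \<open>{i}\<close>, so both classes of Ising models are exponential families
  \<open>exp (\<Sum>S\<in>J. \<theta>\<^sub>S \<chi>\<^sub>S) / Z\<close> on the cube, indexed by a family \<open>J\<close> of nonempty sets with at most two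
  elements: \<open>J\<close> has \<open>m + d\<close> members with fields and \<open>m\<close> members without. With \<open>k\<close> the number of
  members of \<open>J\<close>, both parts say that the minimax rate is of order \<open>min 1 (sqrt (k / n))\<close>.

  Upper bound. This half holds for every exponential family with \<open>k\<close> features on a finite set. The
  set where one member exceeds another is a half-space in the features, so these sets have
  Vapnik-Chervonenkis dimension at most \<open>k + 1\<close> (\<open>vc_positivity_sets\<close>). The estimator picks a member
  of the family whose probabilities of these sets are closest to the empirical frequencies; its
  total variation error is at most twice the largest deviation between frequency and probability,
  up to \<open>1 / n\<close> (\<open>minimum_distance_estimator\<close>). That deviation is
  of order \<open>sqrt (k / n)\<close> in expectation (\<open>uniform_deviation_bound\<close>). A union bound over all traces on
  the sample would lose a logarithm, so after symmetrization the sets are approximated along a chain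
  of packings at scales \<open>2\<^sup>-\<^sup>j\<close>; a packing at scale \<open>\<epsilon>\<close> has at most \<open>(4 / \<epsilon>)\<close> to the power
  \<open>3 (k + 1)\<close> members (\<open>packing_bound\<close>), and the contributions of the scales form a convergent series.

  Lower bound. The hypotheses are the parameters \<open>\<theta> = \<delta> s\<close> with \<open>s\<close> a vector of \<open>k\<close> signs and \<open>\<delta>\<close> of
  order \<open>1 / sqrt (max n k)\<close>. Flipping one sign multiplies every probability by a factor
  \<open>1 + O(\<delta>)\<close>, so \<open>n\<close> samples cannot detect it (\<open>gibbs_close\<close>). On the other hand two such models
  that differ in \<open>h\<close> signs are at distance at least of order \<open>\<delta> sqrt h\<close> (\<open>gibbs_separation\<close>), because
  the difference of their log-densities is a polynomial of degree two in independent signs with second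
  moment at least \<open>4 \<delta>\<^sup>2 h\<close>, and Bonami's inequality bounds its fourth moment, hence its first moment
  from below. This needs the normalizing constant to be bounded. That may fail for some sign vectors,
  but its average over all sign vectors is at most \<open>exp (k \<delta>\<^sup>2 / 2)\<close>, so it holds for most of them, whatever
  the graph (\<open>few_large_weights\<close>). A version of Assouad's lemma that tolerates a small fraction of
  bad hypotheses (\<open>assouad\<close>) combines the two facts into a bound of order \<open>\<delta> sqrt k\<close>.
\<close>

section \<open>Families of finite Vapnik-Chervonenkis dimension\<close>

text \<open>
  Fewer homogeneous equations than unknowns leave a nonzero solution: Gaussian elimination, one
  equation at a time. The unknowns are indexed by an arbitrary finite set because they will be sample
  points, whose number is not a type-level dimension.
\<close>

lemma linear_dependence:
  fixes \<Phi> :: "'j \<Rightarrow> 'i \<Rightarrow> real"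
  assumes "finite J" "finite P" "card J < card P"
  shows "\<exists>c. (\<exists>p\<in>P. c p \<noteq> 0) \<and> (\<forall>j\<in>J. (\<Sum>p\<in>P. c p * \<Phi> j p) = 0)"
  using assms
proof (induction J arbitrary: P \<Phi> rule: finite_induct)
  case empty
  then show ?case
    by (intro exI[of _ "\<lambda>_. 1"]) (auto simp: card_gt_0_iff)
next
  case (insert j J)
  show ?case
  proof (cases "\<forall>p\<in>P. \<Phi> j p = 0")
    case True
    have "card J < card P" using insert by simp
    with insert.IH[OF insert.prems(1), of \<Phi>] True show ?thesis by auto
  next
    case False
    then obtain q where q: "q \<in> P" "\<Phi> j q \<noteq> 0" by blast
    let ?P = "P - {q}"
    have "card J < card ?P" using insert q by simp
    with insert.IH[of ?P "\<lambda>i p. \<Phi> i p - \<Phi> i q * \<Phi> j p / \<Phi> j q"] insert.prems(1)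
    obtain c where c: "\<exists>p\<in>?P. c p \<noteq> 0"
      and c0: "\<And>i. i \<in> J \<Longrightarrow> (\<Sum>p\<in>?P. c p * (\<Phi> i p - \<Phi> i q * \<Phi> j p / \<Phi> j q)) = 0"
      by auto
    define r where "r = - (\<Sum>p\<in>?P. c p * \<Phi> j p) / \<Phi> j q"
    have split: "(\<Sum>p\<in>P. (c(q := r)) p * \<Phi> i p) = r * \<Phi> i q + (\<Sum>p\<in>?P. c p * \<Phi> i p)" for i
      using insert.prems(1) q(1) by (subst sum.remove[of _ q]) (auto intro!: sum.cong)
    have "(\<Sum>p\<in>P. (c(q := r)) p * \<Phi> i p) = 0" if "i \<in> insert j J" for i
    proof (cases "i = j")
      case True
      then show ?thesis using q unfolding split by (simp add: r_def)
    next
      case False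
      with that have "i \<in> J" by simp
      have "(\<Sum>p\<in>?P. c p * (\<Phi> i p - \<Phi> i q * \<Phi> j p / \<Phi> j q))
        = (\<Sum>p\<in>?P. c p * \<Phi> i p) - (\<Sum>p\<in>?P. c p * \<Phi> j p) * (\<Phi> i q / \<Phi> j q)"
        unfolding sum_distrib_right sum_subtractf[symmetric]
        by (rule sum.cong) (simp_all add: right_diff_distrib)
      with c0[OF \<open>i \<in> J\<close>] show ?thesis unfolding split by (simp add: r_def)
    qed
    with c show ?thesis by (intro exI[of _ "c(q := r)"]) auto
  qed
qed

definition shatters :: "'a set set \<Rightarrow> 'a set \<Rightarrow> bool" where
  "shatters \<C> Y \<longleftrightarrow> (\<forall>Z\<subseteq>Y. \<exists>C\<in>\<C>. C \<inter> Y = Z)"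

text \<open>
  The Vapnik-Chervonenkis dimension is at most \<open>D\<close>. Since \<^const>\<open>card\<close> is 0 on infinite sets, only
  finite sets are tested; an infinite shattered set has finite shattered subsets of every size.
\<close>

definition vc_at_most :: "'a set set \<Rightarrow> nat \<Rightarrow> bool" where
  "vc_at_most \<C> D \<longleftrightarrow> (\<forall>Y. finite Y \<longrightarrow> shatters \<C> Y \<longrightarrow> card Y \<le> D)"

lemma vc_at_most_mono: "vc_at_most \<C> D \<Longrightarrow> \<B> \<subseteq> \<C> \<Longrightarrow> vc_at_most \<B> D"
  unfolding vc_at_most_def shatters_def by (meson subset_iff)

text \<open>
  Passing to the indices of a sample does not raise the dimension, even if the sample has
  repetitions: two indices of the same point cannot be separated, so a shattered set of indices
  carries distinct points.
\<close>

lemma vc_at_most_vimage: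
  assumes "vc_at_most \<C> D"
  shows "vc_at_most ((\<lambda>C. {i \<in> I. x i \<in> C}) ` \<C>) D"
  unfolding vc_at_most_def
proof (intro allI impI)
  fix Y assume Y: "finite Y" "shatters ((\<lambda>C. {i \<in> I. x i \<in> C}) ` \<C>) Y"
  have sh: "\<exists>C\<in>\<C>. \<forall>y\<in>Y. (y \<in> I \<and> x y \<in> C) \<longleftrightarrow> y \<in> Z" if "Z \<subseteq> Y" for Z
  proof -
    from Y(2) that obtain C where "C \<in> \<C>" "{i \<in> I. x i \<in> C} \<inter> Y = Z"
      unfolding shatters_def by blast
    then show ?thesis by (intro bexI[of _ C]) auto
  qed
  have YI: "Y \<subseteq> I" using sh[of Y] by auto
  have inj: "inj_on x Y"
  proof (rule inj_onI, rule ccontr)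
    fix a b assume ab: "a \<in> Y" "b \<in> Y" "x a = x b" "a \<noteq> b"
    from sh[of "{a}"] ab obtain C where "\<forall>y\<in>Y. (y \<in> I \<and> x y \<in> C) \<longleftrightarrow> y = a"
      by auto
    with ab YI show False by (metis subsetD)
  qed
  have "shatters \<C> (x ` Y)"
    unfolding shatters_def
  proof (intro allI impI)
    fix Z assume Z: "Z \<subseteq> x ` Y"
    from sh[of "{y\<in>Y. x y \<in> Z}"] obtain C where "C \<in> \<C>"
      "\<forall>y\<in>Y. (y \<in> I \<and> x y \<in> C) \<longleftrightarrow> y \<in> {y\<in>Y. x y \<in> Z}" by blast
    then show "\<exists>C\<in>\<C>. C \<inter> x ` Y = Z" using Z YI by (intro bexI[of _ C]) auto
  qed
  with assms Y(1) have "card (x ` Y) \<le> D" unfolding vc_at_most_def by blast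
  then show "card Y \<le> D" by (simp add: card_image[OF inj])
qed

text \<open>
  More than \<open>card J\<close> points satisfy a linear relation \<open>\<Sum>y. c y * \<Phi> j y = 0\<close> for all features at
  once. No member of the span of the features can then be positive exactly where \<open>c\<close> is: it would make
  every term of the relation nonnegative and at least one term positive.
\<close>

lemma vc_positivity_sets:
  fixes \<Phi> :: "'j \<Rightarrow> 'a \<Rightarrow> real"
  assumes "finite J"
  shows "vc_at_most {{x \<in> X. 0 < (\<Sum>j\<in>J. \<theta> j * \<Phi> j x)} |\<theta>. True} (card J)"
  unfolding vc_at_most_def
proof (intro allI impI, rule ccontr)
  fix Y assume Y: "finite Y" and sh: "shatters {{x \<in> X. 0 < (\<Sum>j\<in>J. \<theta> j * \<Phi> j x)} |\<theta>. True} Y"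
    and "\<not> card Y \<le> card J"
  then obtain c0 p where c0: "p \<in> Y" "c0 p \<noteq> 0" "\<And>j. j \<in> J \<Longrightarrow> (\<Sum>p\<in>Y. c0 p * \<Phi> j p) = 0"
    using linear_dependence[OF assms Y, of \<Phi>] by auto
  \<comment> \<open>the sign is chosen so that \<open>c\<close> is positive somewhere\<close>
  define c where "c x = (if c0 p > 0 then c0 x else - c0 x)" for x
  have c: "c p > 0" "\<And>j. j \<in> J \<Longrightarrow> (\<Sum>p\<in>Y. c p * \<Phi> j p) = 0"
    using c0 by (cases "c0 p > 0"; simp add: c_def sum_negf)+
  from sh obtain \<theta> where \<theta>: "{x \<in> X. 0 < (\<Sum>j\<in>J. \<theta> j * \<Phi> j x)} \<inter> Y = {y \<in> Y. c y > 0}"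
    unfolding shatters_def by (auto dest!: spec[of _ "{y \<in> Y. c y > 0}"])
  have YX: "0 < c y \<Longrightarrow> 0 < (\<Sum>j\<in>J. \<theta> j * \<Phi> j y)" if "y \<in> Y" for y using \<theta> that by blast
  \<comment> \<open>\<open>Y\<close> is itself the trace of a member of the family, and all members lie in \<open>X\<close>\<close>
  have YsubX: "Y \<subseteq> X" using sh unfolding shatters_def by (auto dest!: spec[of _ Y])
  have neg: "c y < 0 \<Longrightarrow> (\<Sum>j\<in>J. \<theta> j * \<Phi> j y) \<le> 0" if "y \<in> Y" for y
  proof (rule ccontr)
    assume "c y < 0" "\<not> (\<Sum>j\<in>J. \<theta> j * \<Phi> j y) \<le> 0"
    then have "y \<in> {x \<in> X. 0 < (\<Sum>j\<in>J. \<theta> j * \<Phi> j x)} \<inter> Y"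
      using that YsubX by auto
    then have "c y > 0" unfolding \<theta> by simp
    with \<open>c y < 0\<close> show False by simp
  qed
  have "0 < (\<Sum>y\<in>Y. c y * (\<Sum>j\<in>J. \<theta> j * \<Phi> j y))"
  proof (rule sum_pos2[OF Y c0(1)])
    show "0 < c p * (\<Sum>j\<in>J. \<theta> j * \<Phi> j p)" using c YX[OF c0(1)] by simp
    show "0 \<le> c y * (\<Sum>j\<in>J. \<theta> j * \<Phi> j y)" if "y \<in> Y" for y
      using YX[OF that] neg[OF that]
      by (cases "c y" "0 :: real" rule: linorder_cases)
         (auto intro: mult_nonpos_nonpos mult_nonneg_nonneg)
  qed
  also have "(\<Sum>y\<in>Y. c y * (\<Sum>j\<in>J. \<theta> j * \<Phi> j y)) = (\<Sum>j\<in>J. \<theta> j * (\<Sum>y\<in>Y. c y * \<Phi> j y))"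
    by (simp add: sum_distrib_left sum.swap[of _ J Y] mult_ac)
  also have "\<dots> = 0" using c by simp
  finally show False by simp
qed

text \<open>
  Induction on the ground set. Split off a point \<open>x\<close>: the family is counted by its trace \<open>C0\<close> without
  \<open>x\<close>, plus the family \<open>C1\<close> of those traces that extend in both ways. Sets shattered by \<open>C0\<close> are
  shattered by the family and avoid \<open>x\<close>; sets shattered by \<open>C1\<close> stay shattered when \<open>x\<close> is added.
\<close>

lemma pajor:
  assumes "finite X" "\<C> \<subseteq> Pow X"
  shows "card \<C> \<le> card {Y. Y \<subseteq> X \<and> shatters \<C> Y}"
  using assms
proof (induction X arbitrary: \<C> rule: finite_induct)
  case empty
  show ?case
  proof (cases "\<C> = {}")
    case False
    have "C = {}" if "C \<in> \<C>" for C using that empty by blast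
    with False have C: "\<C> = {{}}" by blast
    have "{Y. Y \<subseteq> {} \<and> shatters \<C> Y} = {{}}" by (auto simp: shatters_def C)
    then show ?thesis by (simp add: C)
  qed simp
next
  case (insert x X)
  define C0 where "C0 = (\<lambda>C. C - {x}) ` \<C>"
  define C1 where "C1 = {C. C \<subseteq> X \<and> C \<in> \<C> \<and> insert x C \<in> \<C>}"
  have finC: "finite \<C>" using insert by (meson finite.insertI finite_Pow_iff finite_subset)
  have sub: "C0 \<subseteq> Pow X" "C1 \<subseteq> Pow X" using insert.prems by (auto simp: C0_def C1_def)
  define A where "A = {C \<in> \<C>. x \<notin> C}"
  define B where "B = (\<lambda>C. C - {x}) ` {C \<in> \<C>. x \<in> C}"
  have cB: "card B = card {C \<in> \<C>. x \<in> C}"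
    unfolding B_def by (rule card_image) (auto simp: inj_on_def)
  have finAB: "finite A" "finite B" using finC by (auto simp: A_def B_def)
  have "card \<C> = card A + card {C \<in> \<C>. x \<in> C}"
  proof -
    have "\<C> = A \<union> {C \<in> \<C>. x \<in> C}" by (auto simp: A_def)
    then show ?thesis using finC
      by (subst card_Un_disjoint[symmetric]) (auto simp: A_def)
  qed
  also have "\<dots> = card (A \<union> B) + card (A \<inter> B)"
    using card_Un_Int[OF finAB] cB by simp
  also have "A \<union> B = C0"
  proof (intro set_eqI iffI)
    fix C assume "C \<in> A \<union> B"
    then show "C \<in> C0"
    proof
      assume "C \<in> A"
      then have "C = C - {x}" "C \<in> \<C>" by (auto simp: A_def)
      then show ?thesis unfolding C0_def by blast
    qed (auto simp: B_def C0_def)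
  next
    fix C assume "C \<in> C0"
    then obtain C' where C': "C' \<in> \<C>" "C = C' - {x}" by (auto simp: C0_def)
    then show "C \<in> A \<union> B" by (cases "x \<in> C'") (auto simp: A_def B_def)
  qed
  also have "A \<inter> B = C1"
  proof (intro set_eqI iffI)
    fix C assume "C \<in> A \<inter> B"
    then obtain C' where C: "C \<in> \<C>" "x \<notin> C" "C' \<in> \<C>" "x \<in> C'" "C = C' - {x}"
      by (auto simp: A_def B_def)
    then have "insert x C = C'" by blast
    with C insert.prems show "C \<in> C1" by (auto simp: C1_def)
  next
    fix C assume C: "C \<in> C1"
    then have "x \<notin> C" using insert.hyps by (auto simp: C1_def)
    then have "C = insert x C - {x}" by blast
    with C \<open>x \<notin> C\<close> show "C \<in> A \<inter> B" by (auto simp: A_def B_def C1_def)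
  qed
  finally have card: "card \<C> = card C0 + card C1" .
  let ?S = "\<lambda>\<C> X. {Y. Y \<subseteq> X \<and> shatters \<C> Y}"
  have fin: "finite (?S \<C>' X)" for \<C>' using insert.hyps by simp
  have s0: "?S C0 X \<subseteq> {Y \<in> ?S \<C> (insert x X). x \<notin> Y}"
  proof safe
    fix Y assume Y: "Y \<subseteq> X" "shatters C0 Y"
    then have "x \<notin> Y" using insert by blast
    show "shatters \<C> Y"
      unfolding shatters_def
    proof (intro allI impI)
      fix Z assume "Z \<subseteq> Y"
      then obtain C where C: "C \<in> \<C>" "(C - {x}) \<inter> Y = Z"
        using Y(2) unfolding shatters_def C0_def by blast
      then have "C \<inter> Y = Z" using \<open>x \<notin> Y\<close> by blast
      with C show "\<exists>C\<in>\<C>. C \<inter> Y = Z" by blast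
    qed
  qed (use insert in auto)
  have s1: "insert x ` ?S C1 X \<subseteq> {Y \<in> ?S \<C> (insert x X). x \<in> Y}"
  proof safe
    fix Y assume Y: "Y \<subseteq> X" "shatters C1 Y"
    then have xY: "x \<notin> Y" using insert by blast
    show "shatters \<C> (insert x Y)"
      unfolding shatters_def
    proof (intro allI impI)
      fix Z assume Z: "Z \<subseteq> insert x Y"
      then have "Z - {x} \<subseteq> Y" by blast
      then obtain C where C: "C \<in> C1" "C \<inter> Y = Z - {x}" using Y(2) unfolding shatters_def by blast
      then have xC: "x \<notin> C" using insert by (auto simp: C1_def)
      show "\<exists>C\<in>\<C>. C \<inter> insert x Y = Z"
      proof (cases "x \<in> Z")
        case True
        have "insert x C \<inter> insert x Y = Z" using C(2) True xY by blast
        moreover have "insert x C \<in> \<C>" using C(1) by (simp add: C1_def)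
        ultimately show ?thesis by blast
      next
        case False
        have "C \<inter> insert x Y = Z" using C(2) False xY xC by blast
        moreover have "C \<in> \<C>" using C(1) by (simp add: C1_def)
        ultimately show ?thesis by blast
      qed
    qed
  qed auto
  have inj: "inj_on (insert x) (?S C1 X)"
  proof (rule inj_onI)
    fix Y Z assume "Y \<in> ?S C1 X" "Z \<in> ?S C1 X" "insert x Y = insert x Z"
    then show "Y = Z" using insert.hyps by (subst (asm) insert_ident) auto
  qed
  have "card \<C> \<le> card (?S C0 X) + card (?S C1 X)"
    using insert.IH[OF sub(1)] insert.IH[OF sub(2)] card by linarith
  also have "\<dots> = card (?S C0 X) + card (insert x ` ?S C1 X)" by (simp add: card_image[OF inj])
  also have "\<dots> = card (?S C0 X \<union> insert x ` ?S C1 X)"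
    using s0 s1 fin by (intro card_Un_disjoint[symmetric]) auto
  also have "\<dots> \<le> card (?S \<C> (insert x X))"
    using s0 s1 insert.hyps by (intro card_mono) auto
  finally show ?case .
qed

text \<open>
  Pajor's inequality leaves the number of subsets of \<open>X\<close> with at most \<open>D\<close> elements. Weighting a
  subset of size \<open>i\<close> by \<open>t\<close> to the power \<open>i - D\<close>, which is at least 1 for \<open>i \<le> D\<close>, and summing over all
  subsets gives this form, in which the parameter \<open>t\<close> can be fitted to the application.
\<close>

lemma sauer_shelah:
  fixes t :: real
  assumes X: "finite X" "\<C> \<subseteq> Pow X" and vc: "vc_at_most \<C> D" and t: "0 < t" "t \<le> 1"
  shows "real (card \<C>) \<le> (1 / t) ^ D * (1 + t) ^ card X"
proof -
  let ?S = "{Y. Y \<subseteq> X \<and> shatters \<C> Y}"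
  have "real (card \<C>) \<le> real (card ?S)" using pajor[OF X] by simp
  also have "\<dots> = (\<Sum>Y\<in>?S. 1)" by simp
  also have "\<dots> \<le> (\<Sum>Y\<in>?S. (1 / t) ^ D * t ^ card Y)"
  proof (rule sum_mono)
    fix Y assume Y: "Y \<in> ?S"
    then have "card Y \<le> D" using vc X(1) finite_subset unfolding vc_at_most_def by blast
    then have "t ^ D \<le> t ^ card Y" using t by (intro power_decreasing) auto
    then show "1 \<le> (1 / t) ^ D * t ^ card Y" using t by (simp add: field_simps)
  qed
  also have "\<dots> \<le> (\<Sum>Y\<in>Pow X. (1 / t) ^ D * t ^ card Y)"
    using X t by (intro sum_mono2) auto
  also have "\<dots> = (1 / t) ^ D * (\<Sum>Y\<in>Pow X. (\<Prod>x\<in>Y. t) * (\<Prod>x\<in>X-Y. 1))"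
    by (simp add: sum_distrib_left)
  also have "\<dots> = (1 / t) ^ D * (1 + t) ^ card X"
    using prod_add[OF X(1), of "\<lambda>_. t" "\<lambda>_. 1"] by (simp add: add.commute)
  finally show ?thesis .
qed

text \<open>
  Dudley's argument. Draw \<open>k\<close> points of \<open>I\<close> uniformly and independently. Two members of \<open>T\<close> agree on
  all of them with probability at most \<open>exp (- \<epsilon> * k)\<close>, so for \<open>k\<close> slightly above \<open>2 * ln (card T) / \<epsilon>\<close>
  some draw distinguishes all pairs. Then \<open>T\<close> has as many members as traces on \<open>k\<close> points, and the
  Sauer-Shelah bound with \<open>t = \<epsilon> / 4\<close> absorbs half of \<open>ln (card T)\<close>. The bound does not involve
  \<open>card I\<close>; this is what makes chaining free of logarithms.
\<close>

lemma packing_bound: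
  fixes \<epsilon> :: real
  assumes I: "finite I" "T \<subseteq> Pow I" and vc: "vc_at_most T D" and D: "D \<ge> 1"
    and \<epsilon>: "0 < \<epsilon>" "\<epsilon> \<le> 1"
    and sep: "\<And>A B. A \<in> T \<Longrightarrow> B \<in> T \<Longrightarrow> A \<noteq> B \<Longrightarrow> \<epsilon> * real (card I) < real (card (sym_diff A B))"
  shows "ln (real (card T)) \<le> 3 * real D * ln (4 / \<epsilon>)"
proof (cases "card T \<le> 1 \<or> I = {}")
  case True
  have "I = {} \<Longrightarrow> card T \<le> 1" using I by (metis Pow_empty card.empty card_mono card.insert
    finite.simps empty_iff One_nat_def)
  with True have "card T = 0 \<or> card T = 1" by linarith
  then have "ln (card T) = 0" by auto
  moreover have "0 \<le> ln (4 / \<epsilon>)" using \<epsilon> by simp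
  ultimately show ?thesis by simp
next
  case False
  define N where "N = card T"
  define n where "n = card I"
  have N: "N \<ge> 2" using False by (simp add: N_def)
  have n: "n > 0" using False I by (auto simp: n_def card_gt_0_iff)
  have finT: "finite T" using I by (meson finite_Pow_iff finite_subset)
  define k where "k = nat \<lfloor>2 * ln N / \<epsilon>\<rfloor> + 1"
  have lnN: "0 \<le> ln (real N)" using N by simp
  have k1: "2 * ln N / \<epsilon> < k"
    unfolding k_def using lnN \<epsilon> by (simp; linarith)
  have k2: "k \<le> 2 * ln N / \<epsilon> + 1"
    unfolding k_def using lnN \<epsilon> by (simp add: of_nat_floor)
  define F where "F = {..<k} \<rightarrow>\<^sub>E I"
  define Bad where "Bad A B = {..<k} \<rightarrow>\<^sub>E (I - sym_diff A B)" for A B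
  have cardF: "real (card F) = real n ^ k" by (simp add: F_def card_PiE n_def)
  have bad1: "real (card (Bad A B)) \<le> real n ^ k * exp (- \<epsilon> * k)" if AB: "A \<in> T" "B \<in> T" "A \<noteq> B" for A B
  proof -
    have subI: "sym_diff A B \<subseteq> I" using I AB by blast
    have "real (card (I - sym_diff A B)) = real n - real (card (sym_diff A B))"
    proof -
      have "card (I - sym_diff A B) = n - card (sym_diff A B)"
        unfolding n_def by (rule card_Diff_subset[OF finite_subset[OF subI I(1)] subI])
      then show ?thesis using card_mono[OF I(1) subI] by (simp add: n_def of_nat_diff)
    qed
    also have "\<dots> \<le> real n * (1 - \<epsilon>)"
      using sep[OF AB] by (simp add: n_def algebra_simps)
    also have "\<dots> \<le> real n * exp (- \<epsilon>)"
      using exp_ge_add_one_self[of "-\<epsilon>"] by (intro mult_left_mono) auto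
    finally have "real (card (I - sym_diff A B)) ^ k \<le> (real n * exp (- \<epsilon>)) ^ k"
      by (intro power_mono) auto
    then show ?thesis
      by (simp add: Bad_def card_PiE power_mult_distrib exp_of_nat_mult[symmetric] mult_ac)
  qed
  define U where "U = (\<Union>(A,B)\<in>{(A,B)\<in>T\<times>T. A \<noteq> B}. Bad A B)"
  have "real (card U) \<le> real (\<Sum>(A,B)\<in>{(A,B)\<in>T\<times>T. A \<noteq> B}. card (Bad A B))"
    unfolding U_def of_nat_le_iff using finT
    by (intro order.trans[OF card_UN_le]) (auto intro: finite_subset[of _ "T\<times>T"] simp: case_prod_beta)
  also have "\<dots> \<le> (\<Sum>(A,B)\<in>{(A,B)\<in>T\<times>T. A \<noteq> B}. real n ^ k * exp (- \<epsilon> * k))"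
    unfolding of_nat_sum using bad1 by (intro sum_mono) auto
  also have "\<dots> \<le> (\<Sum>(A,B)\<in>T\<times>T. real n ^ k * exp (- \<epsilon> * k))"
    using finT by (intro sum_mono2) auto
  also have "\<dots> = real n ^ k * (real N ^ 2 * exp (- \<epsilon> * k))"
    by (simp add: N_def power2_eq_square mult_ac card_cartesian_product)
  also have "\<dots> < real n ^ k * 1"
  proof (rule mult_strict_left_mono)
    have "2 * ln N < \<epsilon> * k" using k1 \<epsilon> by (simp add: field_simps)
    then have "exp (2 * ln (real N)) < exp (\<epsilon> * k)" by simp
    also have "exp (2 * ln (real N)) = real N ^ 2"
      using N by (simp add: exp_of_nat_mult[of 2, simplified])
    finally show "real N ^ 2 * exp (- \<epsilon> * k) < 1"
      by (simp add: exp_minus field_simps)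
  qed (use n in simp)
  also have "\<dots> = card F" by (simp add: cardF)
  finally have "card U < card F" by simp
  moreover have "finite U"
    unfolding U_def Bad_def using finT I(1)
    by (intro finite_UN_I finite_subset[of "{(A,B)\<in>T\<times>T. A \<noteq> B}" "T\<times>T"]) (auto intro!: finite_PiE)
  ultimately have "\<not> F \<subseteq> U" using card_mono[of U F] by linarith
  then obtain f where f: "f \<in> F" "f \<notin> U" by blast
  define tr where "tr = (\<lambda>A. {j \<in> {..<k}. f j \<in> A})"
  have "inj_on tr T"
  proof (rule inj_onI, rule ccontr)
    fix A B assume AB: "A \<in> T" "B \<in> T" "tr A = tr B" "A \<noteq> B"
    have "f \<in> Bad A B"
      using f(1) AB(3) unfolding Bad_def F_def tr_def by (auto simp: PiE_iff)
    with f(2) AB show False by (auto simp: U_def)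
  qed
  then have "N = card (tr ` T)" by (simp add: card_image N_def)
  also have "real \<dots> \<le> (1 / (\<epsilon>/4)) ^ D * (1 + \<epsilon>/4) ^ card {..<k}"
    using \<epsilon> unfolding tr_def
    by (intro sauer_shelah vc_at_most_vimage vc) auto
  also have "\<dots> \<le> (4 / \<epsilon>) ^ D * exp (\<epsilon> / 4) ^ k"
    using \<epsilon> by (simp add: mult_left_mono power_mono exp_ge_add_one_self)
  finally have "ln (real N) \<le> ln ((4 / \<epsilon>) ^ D * exp (\<epsilon> / 4) ^ k)"
    using N by (intro ln_mono) auto
  also have "\<dots> = D * ln (4 / \<epsilon>) + k * (\<epsilon> / 4)"
    using \<epsilon> by (simp add: ln_mult ln_realpow)
  also have "k * (\<epsilon> / 4) \<le> (2 * ln N / \<epsilon> + 1) * (\<epsilon> / 4)"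
    using k2 \<epsilon> by (intro mult_right_mono) auto
  also have "\<dots> = ln N / 2 + \<epsilon> / 4" using \<epsilon> by (simp add: field_simps)
  finally have "ln N \<le> 2 * D * ln (4 / \<epsilon>) + \<epsilon> / 2" by simp
  moreover have "\<epsilon> / 2 \<le> D * ln (4 / \<epsilon>)"
  proof -
    have "1 \<le> ln (4::real)" using ln_ge_iff[of 4 1] exp_le by simp
    also have "\<dots> \<le> ln (4 / \<epsilon>)" using \<epsilon> by (simp add: field_simps)
    finally have "1 * 1 \<le> D * ln (4 / \<epsilon>)" using D by (intro mult_mono) auto
    then show ?thesis using \<epsilon> by simp
  qed
  ultimately show ?thesis by (simp add: N_def)
qed

section \<open>Averages over finite sets and sign vectors\<close>

definition avg :: "'a set \<Rightarrow> ('a \<Rightarrow> real) \<Rightarrow> real" where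
  "avg A f = (\<Sum>a\<in>A. f a) / card A"

definition signs :: "'i set \<Rightarrow> ('i \<Rightarrow> real) set" where
  "signs I = I \<rightarrow>\<^sub>E {-1, 1}"

lemma finite_signs: "finite I \<Longrightarrow> finite (signs I)"
  by (auto simp: signs_def intro!: finite_PiE)

lemma signs_nonempty: "signs I \<noteq> {}"
  by (simp add: signs_def PiE_eq_empty_iff)

lemma card_signs: "finite I \<Longrightarrow> card (signs I) = 2 ^ card I"
  by (simp add: signs_def card_PiE numeral_2_eq_2)

lemma signsD: "s \<in> signs I \<Longrightarrow> i \<in> I \<Longrightarrow> s i = 1 \<or> s i = -1"
  by (auto simp: signs_def)

lemma avg_mono: "(\<And>a. a \<in> A \<Longrightarrow> f a \<le> g a) \<Longrightarrow> avg A f \<le> avg A g"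
  by (simp add: avg_def divide_right_mono sum_mono)

lemma avg_cong: "A = B \<Longrightarrow> (\<And>a. a \<in> B \<Longrightarrow> f a = g a) \<Longrightarrow> avg A f = avg B g"
  by (simp add: avg_def)

lemma avg_nonneg: "(\<And>a. a \<in> A \<Longrightarrow> 0 \<le> f a) \<Longrightarrow> 0 \<le> avg A f"
  by (simp add: avg_def sum_nonneg)

lemma avg_add: "avg A (\<lambda>a. f a + g a) = avg A f + avg A g"
  by (simp add: avg_def sum.distrib add_divide_distrib)

lemma avg_diff: "avg A (\<lambda>a. f a - g a) = avg A f - avg A g"
  by (simp add: avg_def sum_subtractf diff_divide_distrib)

lemma avg_cmult: "avg A (\<lambda>a. c * f a) = c * avg A f"
  by (simp add: avg_def sum_distrib_left)

lemma avg_multc: "avg A (\<lambda>a. f a * c) = avg A f * c"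
  by (simp add: avg_def sum_distrib_right)

lemma avg_sum: "avg A (\<lambda>a. \<Sum>b\<in>B. f a b) = (\<Sum>b\<in>B. avg A (\<lambda>a. f a b))"
  unfolding avg_def by (subst sum.swap) (simp add: sum_divide_distrib)

lemma avg_const: "finite A \<Longrightarrow> A \<noteq> {} \<Longrightarrow> avg A (\<lambda>_. c) = c"
  by (simp add: avg_def)

lemma avg_indicator:
  "finite A \<Longrightarrow> B \<subseteq> A \<Longrightarrow> avg A (\<lambda>a. if a \<in> B then 1 else 0) = card B / card A"
  by (simp add: avg_def sum.If_cases Int_absorb1)

lemma avg_swap: "avg A (\<lambda>a. avg B (f a)) = avg B (\<lambda>b. avg A (\<lambda>a. f a b))"
  unfolding avg_def by (simp add: sum_divide_distrib sum.swap[of _ A B] mult.commute)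

lemma avg_signs_prod:
  assumes "finite I"
  shows "avg (signs I) (\<lambda>s. \<Prod>i\<in>I. f i (s i)) = (\<Prod>i\<in>I. (f i 1 + f i (-1)) / 2)"
proof -
  have "(\<Sum>s\<in>signs I. \<Prod>i\<in>I. f i (s i)) = (\<Prod>i\<in>I. \<Sum>y\<in>{-1,1}. f i y)"
    unfolding signs_def using assms by (subst prod_sum_PiE) auto
  then show ?thesis
    using assms by (simp add: avg_def card_signs prod_dividef add.commute)
qed

section \<open>Rademacher sums over a family of finite dimension\<close>

lemma sinh_le_mult_cosh: "0 \<le> x \<Longrightarrow> sinh x \<le> x * cosh (x::real)"
proof -
  assume x: "0 \<le> x"
  have "(\<lambda>x. x * cosh x - sinh x) 0 \<le> x * cosh x - sinh x"
  proof (rule DERIV_nonneg_imp_nondecreasing[OF x])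
    fix y :: real assume "0 \<le> y"
    then show "\<exists>z. ((\<lambda>x. x * cosh x - sinh x) has_real_derivative z) (at y) \<and> 0 \<le> z"
      by (intro exI[of _ "y * sinh y"]) (auto intro!: derivative_eq_intros)
  qed
  then show ?thesis by simp
qed

lemma cosh_le_exp_square_half: "cosh (x::real) \<le> exp (x\<^sup>2 / 2)"
proof -
  have pos: "cosh x \<le> exp (x\<^sup>2 / 2)" if x: "0 \<le> x" for x :: real
  proof -
    have "(\<lambda>x. x\<^sup>2 / 2 - ln (cosh x)) 0 \<le> x\<^sup>2 / 2 - ln (cosh x)"
    proof (rule DERIV_nonneg_imp_nondecreasing[OF x])
      fix y :: real assume y: "0 \<le> y"
      have "sinh y / cosh y \<le> y" using sinh_le_mult_cosh[OF y] by (simp add: field_simps)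
      then show "\<exists>z. ((\<lambda>x. x\<^sup>2 / 2 - ln (cosh x)) has_real_derivative z) (at y) \<and> 0 \<le> z"
        by (intro exI[of _ "y - sinh y / cosh y"]) (auto intro!: derivative_eq_intros)
    qed
    then have "ln (cosh x) \<le> x\<^sup>2 / 2" by simp
    then have "exp (ln (cosh x)) \<le> exp (x\<^sup>2 / 2)" by (simp only: exp_le_cancel_iff)
    then show ?thesis by simp
  qed
  show ?thesis using pos[of x] pos[of "-x"] by (cases "0 \<le> x") auto
qed

lemma rademacher_exp_moment:
  assumes "finite I"
  shows "avg (signs I) (\<lambda>s. exp (\<Sum>i\<in>I. s i * v i)) \<le> exp ((\<Sum>i\<in>I. (v i)\<^sup>2) / 2)"
proof -
  have "avg (signs I) (\<lambda>s. exp (\<Sum>i\<in>I. s i * v i)) = (\<Prod>i\<in>I. cosh (v i))"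
    using avg_signs_prod[OF assms, of "\<lambda>i y. exp (y * v i)"] assms
    by (simp add: exp_sum cosh_field_def)
  also have "\<dots> \<le> (\<Prod>i\<in>I. exp ((v i)\<^sup>2 / 2))"
    by (intro prod_mono) (simp add: cosh_le_exp_square_half)
  finally show ?thesis using assms by (simp add: exp_sum[symmetric] sum_divide_distrib)
qed

text \<open>
  The function \<open>M\<close> stands for the maximum of \<open>\<bar>\<Sum>i. s i * v t i\<bar>\<close> over \<open>t\<close>. Its exponential is at most
  the sum of the exponentials of both signs of all the linear forms, each of which is sub-Gaussian;
  the line \<open>y + 1 \<le> exp y\<close> turns the exponential moment into a bound on the mean.
\<close>

lemma massart:
  assumes I: "finite I" and T: "finite T"
    and dom: "\<And>s. s \<in> signs I \<Longrightarrow> \<exists>t\<in>T. M s \<le> \<bar>\<Sum>i\<in>I. s i * v t i\<bar>"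
    and R: "R > 0" "\<And>t. t \<in> T \<Longrightarrow> (\<Sum>i\<in>I. (v t i)\<^sup>2) \<le> R"
    and L: "ln (2 * real (card T)) \<le> L" "L > 0"
  shows "avg (signs I) M \<le> sqrt (2 * R * L)"
proof -
  \<comment> \<open>the value that minimizes the resulting bound \<open>L / b + b * R / 2\<close>\<close>
  define b where "b = sqrt (2 * L / R)"
  have lam: "b > 0" "b\<^sup>2 = 2 * L / R" using R L by (simp_all add: b_def)
  \<comment> \<open>the shift for which the bound on the mean of \<open>exp (b * M s - c)\<close> equals 1\<close>
  define c where "c = L + b\<^sup>2 * R / 2"
  have c: "c = 2 * L" using lam R by (simp add: c_def)
  have Tpos: "card T > 0"
    using dom signs_nonempty[of I] T by (fastforce simp: card_gt_0_iff)
  note [simp] = finite_signs[OF I] signs_nonempty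
  have pt: "b * M s \<le> c - 1 + exp (- c) *
      (\<Sum>t\<in>T. exp (\<Sum>i\<in>I. s i * (b * v t i)) + exp (\<Sum>i\<in>I. s i * (- b * v t i)))"
    if s: "s \<in> signs I" for s
  proof -
    obtain t where t: "t \<in> T" "M s \<le> \<bar>\<Sum>i\<in>I. s i * v t i\<bar>" using dom[OF s] by blast
    let ?y = "\<Sum>i\<in>I. s i * v t i"
    have eq: "(\<Sum>i\<in>I. s i * (b * v u i)) = b * (\<Sum>i\<in>I. s i * v u i)"
      "(\<Sum>i\<in>I. s i * (- b * v u i)) = - b * (\<Sum>i\<in>I. s i * v u i)" for u
      by (simp_all add: sum_distrib_left mult_ac sum_negf)
    have "b * M s - c + 1 \<le> b * \<bar>?y\<bar> - c + 1" using t lam by simp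
    also have "\<dots> \<le> exp (b * \<bar>?y\<bar> - c)" using exp_ge_add_one_self[of "b * \<bar>?y\<bar> - c"] by linarith
    also have "\<dots> = exp (- c) * exp (b * \<bar>?y\<bar>)" by (simp add: exp_diff exp_minus field_simps)
    also have "\<dots> \<le> exp (- c) * (exp (b * ?y) + exp (- b * ?y))"
      by (intro mult_left_mono) (auto simp: abs_if)
    also have "\<dots> \<le> exp (- c) * (\<Sum>t\<in>T. exp (\<Sum>i\<in>I. s i * (b * v t i)) + exp (\<Sum>i\<in>I. s i * (- b * v t i)))"
      unfolding eq using T t(1)
      by (intro mult_left_mono member_le_sum[of t T "\<lambda>t. exp (b * (\<Sum>i\<in>I. s i * v t i)) + exp (- b * (\<Sum>i\<in>I. s i * v t i))"]) auto
    finally show ?thesis by simp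
  qed
  have mom: "avg (signs I) (\<lambda>s. exp (\<Sum>i\<in>I. s i * (\<mu> * v t i))) \<le> exp (b\<^sup>2 * R / 2)"
    if "t \<in> T" "\<mu> = b \<or> \<mu> = - b" for t \<mu>
  proof -
    have "(\<Sum>i\<in>I. (\<mu> * v t i)\<^sup>2) \<le> b\<^sup>2 * R"
      using R(2)[OF that(1)] that(2) by (auto simp: power_mult_distrib sum_distrib_left[symmetric] mult_left_mono)
    then show ?thesis
      by (intro order.trans[OF rademacher_exp_moment[OF I]]) simp
  qed
  have "b * avg (signs I) M = avg (signs I) (\<lambda>s. b * M s)" by (simp add: avg_cmult)
  also have "\<dots> \<le> avg (signs I) (\<lambda>s. c - 1 + exp (- c) *
      (\<Sum>t\<in>T. exp (\<Sum>i\<in>I. s i * (b * v t i)) + exp (\<Sum>i\<in>I. s i * (- b * v t i))))"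
    by (rule avg_mono[OF pt])
  also have "\<dots> = c - 1 + exp (- c) * (\<Sum>t\<in>T. avg (signs I) (\<lambda>s. exp (\<Sum>i\<in>I. s i * (b * v t i)))
      + avg (signs I) (\<lambda>s. exp (\<Sum>i\<in>I. s i * (- b * v t i))))"
    by (simp only: avg_add avg_diff avg_cmult avg_sum avg_const finite_signs[OF I] signs_nonempty
        not_False_eq_True simp_thms)
  also have "\<dots> \<le> c - 1 + exp (- c) * (\<Sum>t\<in>T. exp (b\<^sup>2 * R / 2) + exp (b\<^sup>2 * R / 2))"
    by (intro add_left_mono mult_left_mono sum_mono add_mono mom) auto
  also have "\<dots> = c - 1 + exp (- c) * (2 * card T * exp (b\<^sup>2 * R / 2))"
    by simp
  also have "\<dots> \<le> c - 1 + exp (- c) * (exp L * exp (b\<^sup>2 * R / 2))"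
  proof -
    have "2 * real (card T) = exp (ln (2 * real (card T)))" using Tpos by simp
    also have "\<dots> \<le> exp L" using L by (simp only: exp_le_cancel_iff)
    finally show ?thesis by (intro add_left_mono mult_left_mono mult_right_mono) auto
  qed
  also have "\<dots> = c" by (simp add: c_def exp_add[symmetric] exp_minus)
  finally have "b * avg (signs I) M \<le> 2 * L" using c by simp
  then have "avg (signs I) M \<le> 2 * L / b" using lam by (simp add: field_simps)
  also have "2 * L / b = sqrt (2 * R * L)"
  proof (rule real_sqrt_unique[symmetric])
    show "(2 * L / b)\<^sup>2 = 2 * R * L"
      using L R lam by (simp add: power_divide power2_eq_square[of L] field_simps)
  qed (use L lam in simp)
  finally show ?thesis .
qed

lemma Max_image_ge:
  "finite A \<Longrightarrow> a \<in> A \<Longrightarrow> f a \<le> Max (f ` A)" for f :: "'a \<Rightarrow> real"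
  by simp

text \<open>
  One step of chaining refines the scale from \<open>(1/2) ^ j\<close> to half of it. A maximal subfamily
  separated at the coarser scale comes within \<open>(1/2) ^ j * card I\<close> of every member, so the finer
  maximum exceeds the coarser one by at most the maximum over vectors of small norm, one for each
  member. The packing bound makes the logarithm of their number linear in \<open>j\<close>, and the increment is at
  most \<open>5 * (4/5) ^ j * sqrt (D * card I)\<close>. The constant in the statement adds up these increments.
\<close>

lemma rademacher_separated:
  fixes T :: "'i set set"
  assumes I: "finite I" "card I \<ge> 1" and T: "T \<subseteq> Pow I" "T \<noteq> {}"
    and vc: "vc_at_most T D" and D: "D \<ge> 1"
    and sep: "\<And>A B. A \<in> T \<Longrightarrow> B \<in> T \<Longrightarrow> A \<noteq> B \<Longrightarrow> (1/2) ^ j * card I < card (sym_diff A B)"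
  shows "avg (signs I) (\<lambda>s. Max ((\<lambda>A. \<bar>\<Sum>i\<in>A. s i\<bar>) ` T))
    \<le> sqrt (D * card I) * (27 - 25 * (4/5) ^ j)"
  using T vc sep
proof (induction j arbitrary: T)
  case 0
  define n where "n = card I"
  have single: "A = B" if "A \<in> T" "B \<in> T" for A B
  proof (rule ccontr)
    assume "A \<noteq> B"
    then have "card I < card (sym_diff A B)" using 0(4)[OF that] by simp
    moreover have "card (sym_diff A B) \<le> card I" using that 0(1) I by (intro card_mono) auto
    ultimately show False by simp
  qed
  obtain A where T: "T = {A}" using 0(2) single by blast
  then have A: "A \<subseteq> I" using 0 by simp
  have sum_ind: "(\<Sum>i\<in>A. s i) = (\<Sum>i\<in>I. s i * (if i \<in> A then 1 else 0))" for s :: "'i \<Rightarrow> real"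
    using A I by (simp add: if_distrib sum.If_cases Int_absorb1 cong: if_cong)
  have "avg (signs I) (\<lambda>s. Max ((\<lambda>A. \<bar>\<Sum>i\<in>A. s i\<bar>) ` T)) \<le> sqrt (2 * real n * 1)"
  proof (rule massart[where T = "{A}" and v = "\<lambda>A i. if i \<in> A then 1 else 0"])
    show "ln (2 * real (card {A})) \<le> 1" using ln_le_minus_one[of 2] by simp
    show "(\<Sum>i\<in>I. (if i \<in> t then 1 else 0)\<^sup>2) \<le> real n" if "t \<in> {A}" for t
    proof -
      have "(\<Sum>i\<in>I. (if i \<in> t then 1 else (0::real))\<^sup>2) \<le> (\<Sum>i\<in>I. 1)" by (intro sum_mono) auto
      then show ?thesis by (simp add: n_def)
    qed
  qed (use I in \<open>auto simp: T sum_ind n_def\<close>)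
  also have "\<dots> \<le> sqrt (4 * (D * n))"
  proof -
    have "1 * real n \<le> real D * real n" using D by (intro mult_right_mono) auto
    then show ?thesis by simp
  qed
  also have "\<dots> = sqrt (D * n) * 2" by (simp add: real_sqrt_mult)
  finally show ?case by (simp add: n_def)
next
  case (Suc j)
  define n where "n = card I"
  define K where "K = sqrt (D * n)"
  have n: "n \<ge> 1" using I by (simp add: n_def)
  have finT: "finite T" using Suc.prems(1) I by (meson finite_Pow_iff finite_subset)
  define separated where
    "separated S \<longleftrightarrow> (\<forall>A\<in>S. \<forall>B\<in>S. A \<noteq> B \<longrightarrow> (1/2) ^ j * n < card (sym_diff A B))" for S :: "'i set set"
  obtain A0 where "A0 \<in> T" using Suc.prems by blast
  then have "{A0} \<in> {S. S \<subseteq> T \<and> separated S}" by (simp add: separated_def)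
  then have "\<exists>S\<in>{S. S \<subseteq> T \<and> separated S}. \<forall>S'\<in>{S. S \<subseteq> T \<and> separated S}. S \<subseteq> S' \<longrightarrow> S = S'"
    using finT by (intro finite_has_maximal) auto
  then obtain S where S0: "S \<in> {S. S \<subseteq> T \<and> separated S}"
    and S1: "\<forall>S'\<in>{S. S \<subseteq> T \<and> separated S}. S \<subseteq> S' \<longrightarrow> S = S'"
    by (rule bexE)
  from S0 have S: "S \<subseteq> T" "separated S" by simp_all
  have maxi: "S' = S" if "S' \<subseteq> T" "separated S'" "S \<subseteq> S'" for S'
    using bspec[OF S1, of S'] that by simp
  have "\<exists>B\<in>S. card (sym_diff A B) \<le> (1/2) ^ j * n" if A: "A \<in> T" for A
  proof (rule ccontr)
    assume "\<not> ?thesis"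
    then have far: "\<And>B. B \<in> S \<Longrightarrow> (1/2) ^ j * n < card (sym_diff A B)" by force
    then have "separated (insert A S)"
      using S(2) unfolding separated_def by (auto simp: Un_commute)
    with maxi[of "insert A S"] S A have "A \<in> S" by auto
    from far[OF this] show False using n by (simp add: mult_less_0_iff)
  qed
  then obtain \<pi> where \<pi>: "\<And>A. A \<in> T \<Longrightarrow> \<pi> A \<in> S"
      "\<And>A. A \<in> T \<Longrightarrow> card (sym_diff A (\<pi> A)) \<le> (1/2) ^ j * n"
    by metis
  have Sne: "S \<noteq> {}" using \<pi>(1) \<open>A0 \<in> T\<close> by blast
  have finS: "finite S" using S finT finite_subset by blast
  let ?M = "\<lambda>T s. Max ((\<lambda>A. \<bar>\<Sum>i\<in>A. s i :: real\<bar>) ` T)"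
  let ?v = "\<lambda>A i. (if i \<in> A then 1 else 0) - (if i \<in> \<pi> A then 1 else (0::real))"
  define W where "W s = Max ((\<lambda>A. \<bar>\<Sum>i\<in>I. s i * ?v A i\<bar>) ` T)" for s
  have IH: "avg (signs I) (?M S) \<le> K * (27 - 25 * (4/5) ^ j)"
    unfolding K_def n_def using S Suc.prems Sne
    by (intro Suc.IH) (auto simp: separated_def n_def intro: vc_at_most_mono)
  have sum_ind: "(\<Sum>i\<in>A. s i) = (\<Sum>i\<in>I. s i * (if i \<in> A then 1 else 0))"
    if "A \<in> T" for s :: "'i \<Rightarrow> real" and A
    using that Suc.prems(1) I by (auto simp: if_distrib sum.If_cases Int_absorb1 cong: if_cong)
  have pt: "?M T s \<le> ?M S s + W s" for s
  proof -
    have "\<bar>\<Sum>i\<in>A. s i\<bar> \<le> ?M S s + W s" if A: "A \<in> T" for A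
    proof -
      have "(\<Sum>i\<in>A. s i) = (\<Sum>i\<in>\<pi> A. s i) + (\<Sum>i\<in>I. s i * ?v A i)"
        using sum_ind[OF A] sum_ind[of "\<pi> A"] \<pi>(1)[OF A] S(1)
        by (auto simp: right_diff_distrib sum_subtractf)
      moreover have "\<bar>\<Sum>i\<in>\<pi> A. s i\<bar> \<le> ?M S s" using \<pi>(1)[OF A] finS by (intro Max_image_ge)
      moreover have "\<bar>\<Sum>i\<in>I. s i * ?v A i\<bar> \<le> W s"
        unfolding W_def using A finT by (intro Max_image_ge)
      ultimately show ?thesis by linarith
    qed
    then show ?thesis using finT Suc.prems(2) by simp
  qed
  have W: "avg (signs I) W \<le> sqrt (2 * ((1/2) ^ j * real n) * real (D * (3 * j + 10)))"
  proof (rule massart[where T = T and v = ?v])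
    show "\<exists>t\<in>T. W s \<le> \<bar>\<Sum>i\<in>I. s i * ?v t i\<bar>" for s
    proof -
      have "W s \<in> (\<lambda>A. \<bar>\<Sum>i\<in>I. s i * ?v A i\<bar>) ` T"
        unfolding W_def using finT Suc.prems(2) by (intro Max_in) auto
      then show ?thesis by force
    qed
    show "0 < (1/2) ^ j * real n" using n by simp
    show "(\<Sum>i\<in>I. (?v A i)\<^sup>2) \<le> (1/2) ^ j * real n" if A: "A \<in> T" for A
    proof -
      have "(\<Sum>i\<in>I. (?v A i)\<^sup>2) = (\<Sum>i\<in>I. if i \<in> sym_diff A (\<pi> A) then 1 else 0)"
        by (intro sum.cong) auto
      also have "\<dots> = card (sym_diff A (\<pi> A))"
      proof -
        have "I \<inter> {i. i \<in> sym_diff A (\<pi> A)} = sym_diff A (\<pi> A)"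
          using A \<pi>(1)[OF A] S(1) Suc.prems(1) by blast
        then show ?thesis using I unfolding sum.If_cases[OF I(1)] by simp
      qed
      finally show ?thesis using \<pi>(2)[OF A] by simp
    qed
    show "ln (2 * real (card T)) \<le> real (D * (3 * j + 10))"
    proof -
      have cT: "card T > 0" using finT Suc.prems(2) by (simp add: card_gt_0_iff)
      have "ln (real (card T)) \<le> 3 * real D * ln (4 / (1/2) ^ Suc j)"
        by (rule packing_bound[OF I(1) Suc.prems(1,3) D])
           (use Suc.prems(4) in \<open>simp_all add: power_le_one del: power_Suc\<close>)
      also have "4 / (1/2) ^ Suc j = (2::real) ^ (j + 3)"
        by (simp add: power_add power_divide)
      also have "ln ((2::real) ^ (j + 3)) = (j + 3) * ln 2" by (simp add: ln_realpow)
      also have "3 * real D * ((j + 3) * ln 2) \<le> 3 * real D * ((j + 3) * (1::real))"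
        using ln_le_minus_one[of 2] by (intro mult_left_mono) auto
      finally have "ln (2 * real (card T)) \<le> 1 + 3 * real D * (j + 3)"
        using cT ln_le_minus_one[of 2] by (simp add: ln_mult)
      also have "\<dots> \<le> real (D * (3 * j + 10))" using D by (simp add: algebra_simps)
      finally show ?thesis .
    qed
    show "0 < real (D * (3 * j + 10))" using D by simp
  qed (use I finT in auto)
  have "2 * ((1/2) ^ j * real n) * real (D * (3 * j + 10)) \<le> (D * n) * (5 * (4/5) ^ j)\<^sup>2"
  proof -
    \<comment> \<open>the ratio \<open>32/25\<close> is chosen so that \<open>1/2 * 32/25\<close> is a square, namely that of \<open>4/5\<close>\<close>
    have "1 + real j * (7/25) \<le> (1 + 7/25) ^ j" by (rule Bernoulli_inequality) simp
    then have "6 * real j + 20 \<le> 25 * (32/25) ^ j" by simp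
    then have "(1/2) ^ j * (6 * real j + 20) \<le> (1/2) ^ j * (25 * (32/25) ^ j)"
      by (intro mult_left_mono) auto
    also have "\<dots> = 25 * ((1/2) * (32/25)) ^ j" unfolding power_mult_distrib by simp
    also have "(1/2) * (32/25::real) = (4/5)\<^sup>2" by (simp add: power2_eq_square)
    also have "25 * ((4/5::real)\<^sup>2) ^ j = (5 * (4/5) ^ j)\<^sup>2"
      by (simp add: power_mult_distrib power_mult[symmetric] mult.commute)
    finally have "(D * n) * ((1/2) ^ j * (6 * real j + 20)) \<le> (D * n) * (5 * (4/5) ^ j)\<^sup>2"
      by (intro mult_left_mono) auto
    then show ?thesis by (simp add: algebra_simps)
  qed
  then have "sqrt (2 * ((1/2) ^ j * real n) * real (D * (3 * j + 10))) \<le> sqrt ((D * n) * (5 * (4/5) ^ j)\<^sup>2)"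
    by (simp only: real_sqrt_le_iff)
  also have "\<dots> = K * (5 * (4/5) ^ j)"
    by (simp add: K_def real_sqrt_mult)
  finally have W': "avg (signs I) W \<le> K * (5 * (4/5) ^ j)" using W by linarith
  have "avg (signs I) (?M T) \<le> avg (signs I) (?M S) + avg (signs I) W"
    unfolding avg_add[symmetric] by (intro avg_mono pt)
  also have "\<dots> \<le> K * (27 - 25 * (4/5) ^ j) + K * (5 * (4/5) ^ j)" using IH W' by linarith
  also have "\<dots> = K * (27 - 25 * (4/5) ^ Suc j)" by (simp add: algebra_simps)
  finally show ?case by (simp add: K_def n_def)
qed

text \<open>
  At the scale \<open>(1/2) ^ card I\<close> any two distinct subsets of \<open>I\<close> are separated, so chaining reaches the
  whole family.
\<close>

lemma rademacher_complexity_bound: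
  fixes T :: "'i set set"
  assumes I: "finite I" "card I \<ge> 1" and T: "T \<subseteq> Pow I" "T \<noteq> {}"
    and vc: "vc_at_most T D" and D: "D \<ge> 1"
  shows "avg (signs I) (\<lambda>s. Max ((\<lambda>A. \<bar>\<Sum>i\<in>A. s i\<bar>) ` T)) \<le> 27 * sqrt (D * card I)"
proof -
  have small: "(1/2) ^ card I * real (card I) < 1"
  proof -
    have "real (card I) < 2 ^ card I" by (rule of_nat_less_two_power)
    then show ?thesis by (simp add: power_divide field_simps)
  qed
  have "avg (signs I) (\<lambda>s. Max ((\<lambda>A. \<bar>\<Sum>i\<in>A. s i\<bar>) ` T))
    \<le> sqrt (D * card I) * (27 - 25 * (4/5) ^ card I)"
  proof (rule rademacher_separated[OF I T vc D])
    fix A B assume AB: "A \<in> T" "B \<in> T" "A \<noteq> B"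
    then have "sym_diff A B \<noteq> {}" "sym_diff A B \<subseteq> I" using T by auto
    then have "1 \<le> card (sym_diff A B)"
      using I(1) by (metis One_nat_def Suc_leI card_gt_0_iff finite_subset)
    then show "(1/2) ^ card I * card I < card (sym_diff A B)" using small by linarith
  qed
  also have "\<dots> \<le> sqrt (D * card I) * 27" by (intro mult_left_mono) auto
  finally show ?thesis by (simp add: mult.commute)
qed

section \<open>Samples, likelihoods and the risk as a finite sum\<close>

text \<open>
  Samples are functions on \<open>{..<n}\<close> rather than lists, so that sums over all samples of a product over
  the sample factorize by \<open>prod_sum_PiE\<close>.
\<close>

definition samples :: "'a set \<Rightarrow> nat \<Rightarrow> (nat \<Rightarrow> 'a) set" where
  "samples X n = {..<n} \<rightarrow>\<^sub>E X"

definition likelihood :: "('a \<Rightarrow> real) \<Rightarrow> nat \<Rightarrow> (nat \<Rightarrow> 'a) \<Rightarrow> real" where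
  "likelihood p n x = (\<Prod>i<n. p (x i))"


lemma samplesD: "x \<in> samples X n \<Longrightarrow> i < n \<Longrightarrow> x i \<in> X"
  by (auto simp: samples_def)

lemma likelihood_nonneg:
  "(\<And>a. a \<in> X \<Longrightarrow> 0 \<le> p a) \<Longrightarrow> x \<in> samples X n \<Longrightarrow> 0 \<le> likelihood p n x"
  by (auto simp: likelihood_def samples_def intro!: prod_nonneg)

lemma sum_likelihood_prod:
  fixes p :: "'a \<Rightarrow> real"
  assumes "finite X"
  shows "(\<Sum>x\<in>samples X n. likelihood p n x) = (\<Sum>a\<in>X. p a) ^ n"
  using prod_sum_PiE[of "{..<n}" "\<lambda>_. X" "\<lambda>_. p"] assms
  by (simp add: samples_def likelihood_def)

lemma sum_likelihood_marginal:
  fixes p :: "'a \<Rightarrow> real"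
  assumes X: "finite X" and p: "(\<Sum>a\<in>X. p a) = 1" and i: "i < n"
  shows "(\<Sum>x\<in>samples X n. likelihood p n x * g (x i)) = (\<Sum>a\<in>X. p a * g a)"
proof -
  let ?f = "\<lambda>j a. p a * (if j = i then g a else 1)"
  have "(\<Sum>x\<in>samples X n. likelihood p n x * g (x i)) = (\<Sum>x\<in>samples X n. \<Prod>j<n. ?f j (x j))"
    using i by (intro sum.cong) (simp_all add: prod.distrib likelihood_def)
  also have "\<dots> = (\<Prod>j<n. \<Sum>a\<in>X. ?f j a)"
    unfolding samples_def using X by (intro prod_sum_PiE[symmetric]) auto
  also have "\<dots> = (\<Prod>j<n. if j = i then (\<Sum>a\<in>X. p a * g a) else 1)"
    by (intro prod.cong) (auto simp: p)
  also have "\<dots> = (\<Sum>a\<in>X. p a * g a)" using i by simp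
  finally show ?thesis .
qed

lemma pmf_replicate_pmf:
  "pmf (replicate_pmf n p) xs = (if length xs = n then \<Prod>i<n. pmf p (xs ! i) else 0)"
proof (cases "length xs = n")
  case False
  then have "xs \<notin> set_pmf (replicate_pmf n p)" by (auto simp: set_replicate_pmf)
  with False show ?thesis by (simp add: set_pmf_iff)
next
  case True
  have "pmf (replicate_pmf (length xs) p) xs = (\<Prod>i<length xs. pmf p (xs ! i))"
  proof (induction xs)
    case (Cons x xs)
    have "replicate_pmf (Suc (length xs)) p
        = map_pmf (\<lambda>(x, xs). x # xs) (pair_pmf p (replicate_pmf (length xs) p))"
      by (simp add: pair_pmf_def map_pmf_def bind_assoc_pmf bind_return_pmf)
    moreover have "inj (\<lambda>(x, xs). x # xs)" by (auto simp: inj_def)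
    ultimately have "pmf (replicate_pmf (length (x # xs)) p) (x # xs)
        = pmf (pair_pmf p (replicate_pmf (length xs) p)) (x, xs)"
      using pmf_map_inj'[of "\<lambda>(x, xs). x # xs" _ "(x, xs)"] by simp
    then show ?case
      by (simp add: pmf_pair Cons.IH prod.lessThan_Suc_shift del: prod.lessThan_Suc replicate_pmf.simps)
  qed simp
  with True show ?thesis by simp
qed

lemma restrict_nth_map:
  assumes "x \<in> samples X n"
  shows "(\<lambda>i\<in>{..<n}. map x [0..<n] ! i) = x"
proof (rule ext)
  fix i
  show "(\<lambda>i\<in>{..<n}. map x [0..<n] ! i) i = x i"
    using PiE_arb[of x "{..<n}" "\<lambda>_. X" i] assms by (cases "i < n") (simp_all add: samples_def)
qed

lemma nn_integral_replicate_pmf: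
  assumes X: "finite X" "set_pmf f \<subseteq> X"
  shows "(\<integral>\<^sup>+ xs. h xs \<partial>measure_pmf (replicate_pmf n f))
    = (\<Sum>x\<in>samples X n. ennreal (likelihood (pmf f) n x) * h (map x [0..<n]))"
proof -
  let ?L = "{xs. set xs \<subseteq> X \<and> length xs = n}"
  have "(\<integral>\<^sup>+ xs. h xs \<partial>measure_pmf (replicate_pmf n f))
      = (\<Sum>xs\<in>?L. h xs * pmf (replicate_pmf n f) xs)"
    using X by (intro nn_integral_measure_pmf_support)
      (auto simp: finite_lists_length_eq set_replicate_pmf)
  also have "\<dots> = (\<Sum>x\<in>samples X n. ennreal (likelihood (pmf f) n x) * h (map x [0..<n]))"
  proof (rule sum.reindex_bij_witness[where i = "\<lambda>x. map x [0..<n]" and j = "\<lambda>xs. \<lambda>i\<in>{..<n}. xs ! i"])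
    fix xs assume xs: "xs \<in> ?L"
    then have eq: "map (\<lambda>i\<in>{..<n}. xs ! i) [0..<n] = xs" by (intro nth_equalityI) auto
    then show "map (\<lambda>i\<in>{..<n}. xs ! i) [0..<n] = xs" .
    show "(\<lambda>i\<in>{..<n}. xs ! i) \<in> samples X n" using xs by (auto simp: samples_def)
    show "ennreal (likelihood (pmf f) n (\<lambda>i\<in>{..<n}. xs ! i)) * h (map (\<lambda>i\<in>{..<n}. xs ! i) [0..<n])
        = h xs * ennreal (pmf (replicate_pmf n f) xs)"
      using xs unfolding eq by (simp add: likelihood_def pmf_replicate_pmf mult.commute)
  next
    fix x assume x: "x \<in> samples X n"
    then show "(\<lambda>i\<in>{..<n}. map x [0..<n] ! i) = x" by (rule restrict_nth_map)
    show "map x [0..<n] \<in> ?L" using samplesD[OF x] by auto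
  qed
  finally show ?thesis .
qed

lemma risk_eq_sum:
  assumes "finite X" "\<And>f. f \<in> F \<Longrightarrow> set_pmf f \<subseteq> X"
  shows "risk X n K F = (SUP f\<in>F. \<Sum>x\<in>samples X n. ennreal (likelihood (pmf f) n x) *
           (\<integral>\<^sup>+ g. ennreal (tv_dist X g (pmf f)) \<partial>K (map x [0..<n])))"
  unfolding risk_def using assms by (intro SUP_cong refl nn_integral_replicate_pmf) auto

text \<open>
  The estimator given by a function is turned into a kernel of point masses, restricted to \<open>X\<close>
  because the output space consists of functions that are \<^const>\<open>undefined\<close> outside \<open>X\<close>.
\<close>

lemma minimax_rate_le_deterministic:
  assumes X: "finite X" "\<And>f. f \<in> F \<Longrightarrow> set_pmf f \<subseteq> X"
    and bound: "\<And>f. f \<in> F \<Longrightarrow>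
      (\<Sum>x\<in>samples X n. likelihood (pmf f) n x * tv_dist X (est x) (pmf f)) \<le> r"
  shows "minimax_rate X n F \<le> ennreal r"
proof -
  let ?M = "\<Pi>\<^sub>M x\<in>X. (borel :: real measure)"
  define out where "out xs = restrict (est (\<lambda>i\<in>{..<n}. xs ! i)) X" for xs
  define K where "K xs = return ?M (out xs)" for xs
  have out: "out xs \<in> space ?M" for xs by (simp add: out_def space_PiM)
  have "K \<in> estimators X n"
    unfolding estimators_def measurable_count_space_eq1
    by (auto simp: K_def space_prob_algebra intro!: prob_space_return out)
  then have "minimax_rate X n F \<le> risk X n K F"
    unfolding minimax_rate_def by (rule INF_lower)
  also have "risk X n K F = (SUP f\<in>F. \<Sum>x\<in>samples X n. ennreal (likelihood (pmf f) n x) *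
           (\<integral>\<^sup>+ g. ennreal (tv_dist X g (pmf f)) \<partial>K (map x [0..<n])))"
    by (rule risk_eq_sum[OF X])
  also have "\<dots> \<le> ennreal r"
  proof (rule SUP_least)
    fix f assume f: "f \<in> F"
    have eq: "(\<integral>\<^sup>+ g. ennreal (tv_dist X g (pmf f)) \<partial>K (map x [0..<n]))
        = ennreal (tv_dist X (est x) (pmf f))" if x: "x \<in> samples X n" for x
    proof -
      have "tv_dist X (out (map x [0..<n])) (pmf f) = tv_dist X (est x) (pmf f)"
        by (simp only: out_def restrict_nth_map[OF x]) (simp add: tv_dist_def)
      then show ?thesis
        unfolding K_def by (subst nn_integral_return[OF out measurable_tv_dist[OF X(1)]]) simp
    qed
    have tv: "0 \<le> tv_dist X (est x) (pmf f)" for x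
      by (simp add: tv_dist_def sum_nonneg)
    have "(\<Sum>x\<in>samples X n. ennreal (likelihood (pmf f) n x) *
           (\<integral>\<^sup>+ g. ennreal (tv_dist X g (pmf f)) \<partial>K (map x [0..<n])))
       = (\<Sum>x\<in>samples X n. ennreal (likelihood (pmf f) n x * tv_dist X (est x) (pmf f)))"
      using tv by (intro sum.cong) (simp_all add: eq ennreal_mult likelihood_def prod_nonneg)
    also have "\<dots> = ennreal (\<Sum>x\<in>samples X n. likelihood (pmf f) n x * tv_dist X (est x) (pmf f))"
      using tv by (intro sum_ennreal) (simp add: likelihood_def prod_nonneg)
    also have "\<dots> \<le> ennreal r" by (intro ennreal_leI bound f)
    finally show "(\<Sum>x\<in>samples X n. ennreal (likelihood (pmf f) n x) *
           (\<integral>\<^sup>+ g. ennreal (tv_dist X g (pmf f)) \<partial>K (map x [0..<n]))) \<le> ennreal r" .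
  qed
  finally show ?thesis .
qed

section \<open>Uniform deviation of empirical frequencies\<close>

text \<open>
  Exchanging the \<open>i\<close>-th points of two independent samples preserves their joint likelihood and
  changes the sign of the \<open>i\<close>-th difference.
\<close>

lemma ghost_sample_swap:
  fixes s :: "nat \<Rightarrow> real" and X :: "'a set" and p :: "'a \<Rightarrow> real" and \<phi> :: "'a set \<Rightarrow> 'a \<Rightarrow> real"
  assumes s: "s \<in> signs {..<n}"
  shows "(\<Sum>(x, y)\<in>samples X n \<times> samples X n. likelihood p n x * likelihood p n y *
            Max ((\<lambda>A. \<bar>\<Sum>i<n. \<phi> A (x i) - \<phi> A (y i)\<bar>) ` \<C>))
       = (\<Sum>(x, y)\<in>samples X n \<times> samples X n. likelihood p n x * likelihood p n y *
            Max ((\<lambda>A. \<bar>\<Sum>i<n. s i * (\<phi> A (x i) - \<phi> A (y i))\<bar>) ` \<C>))"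
proof -
  define sw where "sw = (\<lambda>(x, y). (\<lambda>i\<in>{..<n}. if s i = 1 then x i else y i :: 'a,
                                   \<lambda>i\<in>{..<n}. if s i = 1 then y i else x i :: 'a))"
  have inv: "sw (sw z) = z" if "z \<in> samples X n \<times> samples X n" for z
    using that by (auto simp: sw_def samples_def fun_eq_iff PiE_def extensional_def split: prod.splits)
  have mix: "(\<lambda>i\<in>{..<n}. if s i = 1 then u i else v i) \<in> samples X n"
    if "u \<in> samples X n" "v \<in> samples X n" for u v
    unfolding samples_def using that samplesD by (intro restrict_PiE_iff[THEN iffD2] ballI) auto
  have mem: "sw z \<in> samples X n \<times> samples X n" if "z \<in> samples X n \<times> samples X n" for z
    using that mix by (cases z) (simp add: sw_def)
  have F: "(case sw (x, y) of (x, y) \<Rightarrow> likelihood p n x * likelihood p n y *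
            Max ((\<lambda>A. \<bar>\<Sum>i<n. \<phi> A (x i) - \<phi> A (y i)\<bar>) ` \<C>))
      = likelihood p n x * likelihood p n y *
            Max ((\<lambda>A. \<bar>\<Sum>i<n. s i * (\<phi> A (x i) - \<phi> A (y i))\<bar>) ` \<C>)" for x y
  proof -
    obtain x' y' where xy: "sw (x, y) = (x', y')" by fastforce
    have x': "x' i = (if s i = 1 then x i else y i)" "y' i = (if s i = 1 then y i else x i)" if "i < n" for i
      using that xy by (auto simp: sw_def)
    have "likelihood p n x' * likelihood p n y' = likelihood p n x * likelihood p n y"
      unfolding likelihood_def prod.distrib[symmetric]
      by (intro prod.cong) (auto simp: x')
    moreover have "(\<Sum>i<n. \<phi> A (x' i) - \<phi> A (y' i)) = (\<Sum>i<n. s i * (\<phi> A (x i) - \<phi> A (y i)))" for A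
    proof (intro sum.cong refl)
      fix i assume "i \<in> {..<n}"
      then show "\<phi> A (x' i) - \<phi> A (y' i) = s i * (\<phi> A (x i) - \<phi> A (y i))"
        using signsD[OF s, of i] by (cases "s i = 1") (auto simp: x')
    qed
    ultimately show ?thesis by (simp add: xy)
  qed
  show ?thesis
    by (rule sum.reindex_bij_witness[where i = sw and j = sw])
       (use inv mem F[symmetric] in \<open>auto split: prod.splits\<close>)
qed

text \<open>
  The mean of \<open>\<phi> A\<close> is the average of its sum over an independent second sample, which bounds the
  deviation by the maximal difference between the two samples. By the swap symmetry the differences
  may be given arbitrary signs; averaging over the signs and separating the two samples leaves two
  Rademacher averages.
\<close>

lemma symmetrization:
  fixes p :: "'a \<Rightarrow> real" and \<phi> :: "'a set \<Rightarrow> 'a \<Rightarrow> real"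
  assumes X: "finite X" and p: "\<And>a. a \<in> X \<Longrightarrow> 0 \<le> p a" "(\<Sum>a\<in>X. p a) = 1"
    and C: "finite \<C>" "\<C> \<noteq> {}"
    and B: "\<And>x. x \<in> samples X n \<Longrightarrow>
      avg (signs {..<n}) (\<lambda>s. Max ((\<lambda>A. \<bar>\<Sum>i<n. s i * \<phi> A (x i)\<bar>) ` \<C>)) \<le> B"
  shows "(\<Sum>x\<in>samples X n. likelihood p n x *
      Max ((\<lambda>A. \<bar>(\<Sum>i<n. \<phi> A (x i)) - real n * (\<Sum>a\<in>X. p a * \<phi> A a)\<bar>) ` \<C>)) \<le> 2 * B"
proof -
  let ?S = "samples X n" and ?w = "likelihood p n"
  have w0: "0 \<le> ?w x" if "x \<in> ?S" for x using likelihood_nonneg[OF p(1) that] by simp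
  have w1: "(\<Sum>x\<in>?S. ?w x) = 1" by (simp add: sum_likelihood_prod[OF X] p)
  define D where "D x y = Max ((\<lambda>A. \<bar>\<Sum>i<n. \<phi> A (x i) - \<phi> A (y i)\<bar>) ` \<C>)" for x y
  define R where "R s x = Max ((\<lambda>A. \<bar>\<Sum>i<n. s i * \<phi> A (x i)\<bar>) ` \<C>)" for s :: "nat \<Rightarrow> real" and x
  have ghost: "Max ((\<lambda>A. \<bar>(\<Sum>i<n. \<phi> A (x i)) - real n * (\<Sum>a\<in>X. p a * \<phi> A a)\<bar>) ` \<C>)
      \<le> (\<Sum>y\<in>?S. ?w y * D x y)" for x
  proof -
    have "\<bar>(\<Sum>i<n. \<phi> A (x i)) - real n * (\<Sum>a\<in>X. p a * \<phi> A a)\<bar> \<le> (\<Sum>y\<in>?S. ?w y * D x y)"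
      if A: "A \<in> \<C>" for A
    proof -
      have "(\<Sum>y\<in>?S. ?w y * (\<Sum>i<n. \<phi> A (x i) - \<phi> A (y i)))
          = (\<Sum>i<n. \<Sum>y\<in>?S. ?w y * \<phi> A (x i) - ?w y * \<phi> A (y i))"
        by (simp only: sum_distrib_left right_diff_distrib sum.swap[of _ "{..<n}"])
      also have "\<dots> = (\<Sum>i<n. \<phi> A (x i) - (\<Sum>a\<in>X. p a * \<phi> A a))"
        using w1 sum_likelihood_marginal[OF X p(2), of _ n "\<phi> A"]
        by (intro sum.cong) (simp_all add: sum_subtractf sum_distrib_right[symmetric])
      also have "\<dots> = (\<Sum>i<n. \<phi> A (x i)) - real n * (\<Sum>a\<in>X. p a * \<phi> A a)"
        by (simp add: sum_subtractf)
      finally have "\<bar>(\<Sum>i<n. \<phi> A (x i)) - real n * (\<Sum>a\<in>X. p a * \<phi> A a)\<bar>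
          = \<bar>\<Sum>y\<in>?S. ?w y * (\<Sum>i<n. \<phi> A (x i) - \<phi> A (y i))\<bar>" by simp
      also have "\<dots> \<le> (\<Sum>y\<in>?S. \<bar>?w y * (\<Sum>i<n. \<phi> A (x i) - \<phi> A (y i))\<bar>)" by (rule sum_abs)
      also have "\<dots> \<le> (\<Sum>y\<in>?S. ?w y * D x y)"
      proof (rule sum_mono)
        fix y assume y: "y \<in> ?S"
        have "\<bar>\<Sum>i<n. \<phi> A (x i) - \<phi> A (y i)\<bar> \<le> D x y"
          unfolding D_def using A C by (intro Max_image_ge)
        then show "\<bar>?w y * (\<Sum>i<n. \<phi> A (x i) - \<phi> A (y i))\<bar> \<le> ?w y * D x y"
          using w0[OF y] by (simp add: abs_mult mult_left_mono)
      qed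
      finally show ?thesis .
    qed
    then show ?thesis using C by simp
  qed
  let ?D = "\<Sum>(x, y)\<in>?S \<times> ?S. ?w x * ?w y * D x y"
  have "(\<Sum>x\<in>?S. ?w x * Max ((\<lambda>A. \<bar>(\<Sum>i<n. \<phi> A (x i)) - real n * (\<Sum>a\<in>X. p a * \<phi> A a)\<bar>) ` \<C>))
      \<le> (\<Sum>x\<in>?S. ?w x * (\<Sum>y\<in>?S. ?w y * D x y))"
    by (intro sum_mono mult_left_mono ghost w0)
  also have "\<dots> = ?D"
    by (simp add: sum.cartesian_product[symmetric] sum_distrib_left mult.assoc)
  also have "?D \<le> 2 * B"
  proof -
    have "?D \<le> 2 * (\<Sum>x\<in>?S. ?w x * R s x)" if s: "s \<in> signs {..<n}" for s
    proof -
      have "?D = (\<Sum>(x, y)\<in>?S \<times> ?S. ?w x * ?w y *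
            Max ((\<lambda>A. \<bar>\<Sum>i<n. s i * (\<phi> A (x i) - \<phi> A (y i))\<bar>) ` \<C>))"
        unfolding D_def by (rule ghost_sample_swap[OF s])
      also have "\<dots> \<le> (\<Sum>(x, y)\<in>?S \<times> ?S. ?w x * ?w y * (R s x + R s y))"
      proof (rule sum_mono, clarify)
        fix x y assume xy: "x \<in> ?S" "y \<in> ?S"
        have "\<bar>\<Sum>i<n. s i * (\<phi> A (x i) - \<phi> A (y i))\<bar> \<le> R s x + R s y" if A: "A \<in> \<C>" for A
        proof -
          have "\<bar>\<Sum>i<n. s i * (\<phi> A (x i) - \<phi> A (y i))\<bar>
              \<le> \<bar>\<Sum>i<n. s i * \<phi> A (x i)\<bar> + \<bar>\<Sum>i<n. s i * \<phi> A (y i)\<bar>"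
            by (simp add: right_diff_distrib sum_subtractf)
          moreover have "\<bar>\<Sum>i<n. s i * \<phi> A (z i)\<bar> \<le> R s z" for z
            unfolding R_def using A C by (intro Max_image_ge)
          ultimately show ?thesis by (meson add_mono order_trans)
        qed
        then have "Max ((\<lambda>A. \<bar>\<Sum>i<n. s i * (\<phi> A (x i) - \<phi> A (y i))\<bar>) ` \<C>) \<le> R s x + R s y"
          using C by simp
        then show "?w x * ?w y * Max ((\<lambda>A. \<bar>\<Sum>i<n. s i * (\<phi> A (x i) - \<phi> A (y i))\<bar>) ` \<C>)
            \<le> ?w x * ?w y * (R s x + R s y)"
          using w0 xy by (intro mult_left_mono) auto
      qed
      also have "\<dots> = (\<Sum>x\<in>?S. \<Sum>y\<in>?S. ?w x * R s x * ?w y) + (\<Sum>x\<in>?S. \<Sum>y\<in>?S. ?w x * (?w y * R s y))"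
        by (simp add: sum.cartesian_product[symmetric] sum.distrib[symmetric] algebra_simps)
      also have "\<dots> = 2 * (\<Sum>x\<in>?S. ?w x * R s x)"
        by (simp only: sum_distrib_left[symmetric] sum_distrib_right[symmetric] w1)
      finally show ?thesis .
    qed
    then have "avg (signs {..<n}) (\<lambda>_. ?D) \<le> avg (signs {..<n}) (\<lambda>s. 2 * (\<Sum>x\<in>?S. ?w x * R s x))"
      by (rule avg_mono)
    also have "\<dots> = 2 * (\<Sum>x\<in>?S. ?w x * avg (signs {..<n}) (\<lambda>s. R s x))"
      by (simp only: avg_cmult avg_sum)
    also have "\<dots> \<le> 2 * (\<Sum>x\<in>?S. ?w x * B)"
      using B w0 by (intro mult_left_mono sum_mono) (auto simp: R_def)
    also have "\<dots> = 2 * B" by (simp add: sum_distrib_right[symmetric] w1)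
    finally show ?thesis by (simp add: avg_const finite_signs signs_nonempty)
  qed
  finally show ?thesis .
qed

definition deviation :: "'a set set \<Rightarrow> nat \<Rightarrow> (nat \<Rightarrow> 'a) \<Rightarrow> 'a set \<Rightarrow> ('a \<Rightarrow> real) \<Rightarrow> real" where
  "deviation \<C> n x X p =
     Max ((\<lambda>A. \<bar>(\<Sum>i<n. indicator A (x i)) / n - (\<Sum>a\<in>X. p a * indicator A a)\<bar>) ` \<C>)"

lemma uniform_deviation_bound:
  fixes p :: "'a \<Rightarrow> real"
  assumes X: "finite X" and p: "\<And>a. a \<in> X \<Longrightarrow> 0 \<le> p a" "(\<Sum>a\<in>X. p a) = 1"
    and C: "\<C> \<subseteq> Pow X" "\<C> \<noteq> {}" and vc: "vc_at_most \<C> D" "D \<ge> 1" and n: "n \<ge> 1"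
  shows "(\<Sum>x\<in>samples X n. likelihood p n x * deviation \<C> n x X p) \<le> 54 * sqrt (D / n)"
proof -
  have finC: "finite \<C>" using C X by (meson finite_Pow_iff finite_subset)
  let ?\<phi> = "\<lambda>A a. indicator A a :: real"
  have "(\<Sum>x\<in>samples X n. likelihood p n x *
      Max ((\<lambda>A. \<bar>(\<Sum>i<n. ?\<phi> A (x i)) - real n * (\<Sum>a\<in>X. p a * ?\<phi> A a)\<bar>) ` \<C>)) \<le> 2 * (27 * sqrt (D * n))"
  proof (rule symmetrization[OF X p finC C(2)])
    fix x :: "nat \<Rightarrow> 'a"
    let ?tr = "\<lambda>A. {i \<in> {..<n}. x i \<in> A}"
    have "(\<Sum>i<n. s i * ?\<phi> A (x i)) = (\<Sum>i\<in>?tr A. s i)" for s A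
      unfolding sum.inter_filter[OF finite_lessThan] by (intro sum.cong) (auto simp: indicator_def)
    then have "avg (signs {..<n}) (\<lambda>s. Max ((\<lambda>A. \<bar>\<Sum>i<n. s i * ?\<phi> A (x i)\<bar>) ` \<C>))
        = avg (signs {..<n}) (\<lambda>s. Max ((\<lambda>A. \<bar>\<Sum>i\<in>A. s i\<bar>) ` (?tr ` \<C>)))"
      by (simp add: image_image)
    also have "\<dots> \<le> 27 * sqrt (D * card {..<n})"
      using n C(2) by (intro rademacher_complexity_bound vc_at_most_vimage vc) auto
    finally show "avg (signs {..<n}) (\<lambda>s. Max ((\<lambda>A. \<bar>\<Sum>i<n. s i * ?\<phi> A (x i)\<bar>) ` \<C>)) \<le> 27 * sqrt (D * n)"
      by simp
  qed
  moreover have "Max ((\<lambda>A. \<bar>(\<Sum>i<n. ?\<phi> A (x i)) - real n * (\<Sum>a\<in>X. p a * ?\<phi> A a)\<bar>) ` \<C>)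
      = n * deviation \<C> n x X p" for x
  proof -
    have "\<bar>(\<Sum>i<n. ?\<phi> A (x i)) - real n * (\<Sum>a\<in>X. p a * ?\<phi> A a)\<bar>
       = n * \<bar>(\<Sum>i<n. ?\<phi> A (x i)) / n - (\<Sum>a\<in>X. p a * ?\<phi> A a)\<bar>" for A
      using n abs_mult[of "real n" "(\<Sum>i<n. ?\<phi> A (x i)) / n - (\<Sum>a\<in>X. p a * ?\<phi> A a)"]
      by (simp add: right_diff_distrib)
    then have "(\<lambda>A. \<bar>(\<Sum>i<n. ?\<phi> A (x i)) - real n * (\<Sum>a\<in>X. p a * ?\<phi> A a)\<bar>) ` \<C>
        = (\<lambda>r. n * r) ` (\<lambda>A. \<bar>(\<Sum>i<n. ?\<phi> A (x i)) / n - (\<Sum>a\<in>X. p a * ?\<phi> A a)\<bar>) ` \<C>"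
      by (simp add: image_image)
    then show ?thesis
      unfolding deviation_def using finC C(2)
      by (subst mono_Max_commute[of "\<lambda>r. real n * r"]) (auto intro!: monoI mult_left_mono)
  qed
  ultimately have "n * (\<Sum>x\<in>samples X n. likelihood p n x * deviation \<C> n x X p) \<le> 54 * sqrt (D * n)"
    by (simp add: sum_distrib_left mult_ac)
  then have "(\<Sum>x\<in>samples X n. likelihood p n x * deviation \<C> n x X p) \<le> 54 * sqrt (D * n) / n"
    using n by (simp add: field_simps)
  also have "54 * sqrt (D * n) / n = 54 * sqrt (D / n)"
    using n by (simp add: real_sqrt_mult real_sqrt_divide field_simps)
  finally show ?thesis .
qed

section \<open>Minimum distance estimation and the upper bound for exponential families\<close>

text \<open>
  Both functions have total mass 1 on \<open>X\<close>, so the positive and the negative part of the difference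
  have the same mass.
\<close>

lemma tv_dist_pmf_eq:
  assumes X: "finite X" "set_pmf f \<subseteq> X" "set_pmf g \<subseteq> X"
  shows "tv_dist X (pmf g) (pmf f)
    = (\<Sum>a\<in>X. pmf g a * indicator {a\<in>X. pmf f a < pmf g a} a)
      - (\<Sum>a\<in>X. pmf f a * indicator {a\<in>X. pmf f a < pmf g a} a)"
proof -
  let ?A = "{a\<in>X. pmf f a < pmf g a}"
  have one: "(\<Sum>a\<in>X. pmf f a) = 1" "(\<Sum>a\<in>X. pmf g a) = 1" using X by (auto intro: sum_pmf_eq_1)
  have "(\<Sum>a\<in>X. \<bar>pmf g a - pmf f a\<bar>)
     = (\<Sum>a\<in>X. 2 * ((pmf g a - pmf f a) * indicator ?A a) - (pmf g a - pmf f a))"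
    by (intro sum.cong) (auto simp: indicator_def)
  also have "\<dots> = 2 * (\<Sum>a\<in>X. (pmf g a - pmf f a) * indicator ?A a)"
    by (simp add: sum_subtractf sum_distrib_left one)
  finally show ?thesis by (simp add: tv_dist_def left_diff_distrib sum_subtractf)
qed

text \<open>
  Yatracos' estimator. If the data satisfy \<open>deviation \<C> n x X (pmf f) \<le> r\<close> for the true \<open>f\<close>, the
  chosen member has deviation at most \<open>r + 1 / n\<close>. Total variation between two members is attained on
  a set of \<open>\<C>\<close>, where both are close to the same empirical frequency, so it is at most
  \<open>2 * r + 1 / n\<close>.
\<close>

theorem minimum_distance_estimator:
  fixes F :: "'a pmf set"
  assumes X: "finite X" "\<And>f. f \<in> F \<Longrightarrow> set_pmf f \<subseteq> X" and F: "F \<noteq> {}"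
    and C: "\<C> \<subseteq> Pow X" and vc: "vc_at_most \<C> D" "D \<ge> 1" and n: "n \<ge> 1"
    and yatracos: "\<And>f g. f \<in> F \<Longrightarrow> g \<in> F \<Longrightarrow> {a\<in>X. pmf f a < pmf g a} \<in> \<C>"
  shows "minimax_rate X n F \<le> ennreal (109 * min 1 (sqrt (D / n)))"
proof -
  have finC: "finite \<C>" using C X by (meson finite_Pow_iff finite_subset)
  have Cne: "\<C> \<noteq> {}" using F yatracos by blast
  let ?\<Delta> = "\<lambda>x f. deviation \<C> n x X (pmf f)"
  have D0: "0 \<le> ?\<Delta> x f" for x f
  proof -
    obtain A where A: "A \<in> \<C>" using Cne by blast
    have "0 \<le> \<bar>(\<Sum>i<n. indicator A (x i)) / n - (\<Sum>a\<in>X. pmf f a * indicator A a)\<bar>" by simp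
    also have "\<dots> \<le> ?\<Delta> x f" unfolding deviation_def using finC A by (intro Max_image_ge)
    finally show ?thesis .
  qed
  \<comment> \<open>the infimum over a possibly infinite family \<open>F\<close> need not be attained, hence the slack \<open>1 / n\<close>\<close>
  have "\<exists>g\<in>F. \<forall>f\<in>F. ?\<Delta> x g \<le> ?\<Delta> x f + 1 / n" for x
  proof -
    let ?V = "?\<Delta> x ` F"
    have bdd: "bdd_below ?V" using D0 by (auto intro!: bdd_belowI[of _ 0])
    have "\<exists>v\<in>?V. v < Inf ?V + 1 / n"
      using F n by (intro cInf_lessD) auto
    then obtain g where "g \<in> F" "?\<Delta> x g < Inf ?V + 1 / n" by auto
    moreover have "Inf ?V \<le> ?\<Delta> x f" if "f \<in> F" for f
      using that bdd by (intro cInf_lower) auto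
    ultimately show ?thesis by (intro bexI[of _ g]) force+
  qed
  then obtain est where est: "\<And>x. est x \<in> F" "\<And>x f. f \<in> F \<Longrightarrow> ?\<Delta> x (est x) \<le> ?\<Delta> x f + 1 / n"
    by metis
  show ?thesis
  proof (rule minimax_rate_le_deterministic[where est = "\<lambda>x. pmf (est x)", OF X])
    fix f assume f: "f \<in> F"
    have one: "(\<Sum>a\<in>X. pmf f a) = 1" if "f \<in> F" for f using X that by (auto intro: sum_pmf_eq_1)
    let ?S = "samples X n" and ?w = "likelihood (pmf f) n"
    have w0: "0 \<le> ?w x" for x by (simp add: likelihood_def prod_nonneg)
    have w1: "(\<Sum>x\<in>?S. ?w x) = 1" by (simp add: sum_likelihood_prod[OF X(1)] one[OF f])
    have tv1: "tv_dist X (pmf (est x)) (pmf f) \<le> 1" for x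
    proof -
      have "(\<Sum>a\<in>X. \<bar>pmf (est x) a - pmf f a\<bar>) \<le> (\<Sum>a\<in>X. pmf (est x) a + pmf f a)"
        by (intro sum_mono) (simp add: abs_le_iff)
      also have "\<dots> = 2" by (simp add: sum.distrib one f est)
      finally show ?thesis by (simp add: tv_dist_def)
    qed
    have tv2: "tv_dist X (pmf (est x)) (pmf f) \<le> 2 * ?\<Delta> x f + 1 / n" for x
    proof -
      let ?A = "{a\<in>X. pmf f a < pmf (est x) a}"
      have A: "?A \<in> \<C>" using yatracos f est by blast
      have dev: "\<bar>(\<Sum>i<n. indicator ?A (x i)) / n - (\<Sum>a\<in>X. pmf g a * indicator ?A a)\<bar> \<le> ?\<Delta> x g" for g
        unfolding deviation_def using finC A by (rule Max_image_ge)
      have "tv_dist X (pmf (est x)) (pmf f)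
         = (\<Sum>a\<in>X. pmf (est x) a * indicator ?A a) - (\<Sum>a\<in>X. pmf f a * indicator ?A a)"
        by (rule tv_dist_pmf_eq) (use X f est in auto)
      also have "\<dots> \<le> ?\<Delta> x (est x) + ?\<Delta> x f"
        using dev[of "est x"] dev[of f] by linarith
      also have "\<dots> \<le> 2 * ?\<Delta> x f + 1 / n" using est(2)[OF f, of x] by simp
      finally show ?thesis .
    qed
    have "(\<Sum>x\<in>?S. ?w x * tv_dist X (pmf (est x)) (pmf f)) \<le> (\<Sum>x\<in>?S. ?w x * 1)"
      by (intro sum_mono mult_left_mono tv1 w0)
    then have le1: "(\<Sum>x\<in>?S. ?w x * tv_dist X (pmf (est x)) (pmf f)) \<le> 1" by (simp add: w1)
    have "(\<Sum>x\<in>?S. ?w x * tv_dist X (pmf (est x)) (pmf f)) \<le> (\<Sum>x\<in>?S. ?w x * (2 * ?\<Delta> x f + 1 / n))"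
      by (intro sum_mono mult_left_mono tv2 w0)
    also have "\<dots> = 2 * (\<Sum>x\<in>?S. ?w x * ?\<Delta> x f) + (\<Sum>x\<in>?S. ?w x) / n"
      by (simp add: sum.distrib distrib_left sum_distrib_left sum_divide_distrib mult_ac)
    also have "\<dots> \<le> 2 * (54 * sqrt (D / n)) + 1 / n"
      using uniform_deviation_bound[OF X(1) _ one[OF f] C Cne vc n] by (simp add: w1)
    also have "1 / n \<le> sqrt (D / n)"
    proof (rule real_le_rsqrt)
      have "(1 / real n)\<^sup>2 = (1 / n) * (1 / n)" by (simp add: power2_eq_square)
      also have "\<dots> \<le> D * (1 / n)"
      proof (rule mult_right_mono)
        have "1 / real n \<le> 1" "1 \<le> real D" using n vc(2) by simp_all
        then show "1 / real n \<le> D" by linarith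
      qed simp
      finally show "(1 / real n)\<^sup>2 \<le> D / n" by simp
    qed
    finally have "(\<Sum>x\<in>?S. ?w x * tv_dist X (pmf (est x)) (pmf f)) \<le> 109 * sqrt (D / n)" by simp
    with le1 show "(\<Sum>x\<in>?S. ?w x * tv_dist X (pmf (est x)) (pmf f)) \<le> 109 * min 1 (sqrt (D / n))"
      by (simp add: min_def)
  qed
qed

definition gibbs_pmf :: "'a set \<Rightarrow> ('a \<Rightarrow> real) \<Rightarrow> 'a pmf" where
  "gibbs_pmf X T = embed_pmf (\<lambda>x. if x \<in> X then exp (T x) / (\<Sum>y\<in>X. exp (T y)) else 0)"

lemma pmf_gibbs:
  assumes X: "finite X" "X \<noteq> {}"
  shows "pmf (gibbs_pmf X T) x = (if x \<in> X then exp (T x) / (\<Sum>y\<in>X. exp (T y)) else 0)"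
  unfolding gibbs_pmf_def
proof (rule pmf_embed_pmf)
  let ?Z = "\<Sum>y\<in>X. exp (T y)"
  let ?f = "\<lambda>x. if x \<in> X then exp (T x) / ?Z else 0"
  have Z: "?Z > 0" using X by (intro sum_pos) auto
  show nonneg: "0 \<le> ?f x" for x using Z by simp
  have "(\<integral>\<^sup>+x. ennreal (?f x) \<partial>count_space UNIV) = (\<Sum>x\<in>X. ennreal (?f x))"
    by (rule nn_integral_count_space') (auto simp: X)
  also have "\<dots> = ennreal (\<Sum>x\<in>X. ?f x)" by (rule sum_ennreal) (rule nonneg)
  also have "(\<Sum>x\<in>X. ?f x) = 1" using Z by (simp flip: sum_divide_distrib)
  finally show "(\<integral>\<^sup>+x. ennreal (?f x) \<partial>count_space UNIV) = 1" by simp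
qed

lemma set_gibbs:
  assumes X: "finite X" "X \<noteq> {}"
  shows "set_pmf (gibbs_pmf X T) = X"
proof -
  have "(\<Sum>y\<in>X. exp (T y)) > 0" using X by (intro sum_pos) auto
  then show ?thesis by (auto simp: set_pmf_eq pmf_gibbs[OF X])
qed

definition exp_family :: "'a set \<Rightarrow> 'j set \<Rightarrow> ('j \<Rightarrow> 'a \<Rightarrow> real) \<Rightarrow> 'a pmf set" where
  "exp_family X J \<Phi> = {gibbs_pmf X (\<lambda>x. \<Sum>j\<in>J. \<theta> j * \<Phi> j x) |\<theta>. True}"

text \<open>
  Comparing two densities of the family amounts to a linear inequality in the features together with
  a constant for the ratio of the normalizing sums. The constant is an additional feature, indexed by
  \<^const>\<open>None\<close>, and gives dimension \<open>card J + 1 \<le> 2 * card J\<close>. The empty feature set is treated separately: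
  the family has a single member and the rate is 0.
\<close>

theorem minimax_exp_family_upper:
  assumes X: "finite X" "X \<noteq> {}" and J: "finite J" and n: "n \<ge> 1"
  shows "minimax_rate X n (exp_family X J \<Phi>) \<le> ennreal (218 * min 1 (sqrt (card J / n)))"
proof (cases "J = {}")
  case True
  have "minimax_rate X n (exp_family X J \<Phi>) \<le> ennreal 0"
    by (rule minimax_rate_le_deterministic[where est = "\<lambda>_. pmf (gibbs_pmf X (\<lambda>_. 0))"])
       (use X in \<open>auto simp: exp_family_def True set_gibbs tv_dist_def\<close>)
  with True show ?thesis by simp
next
  case False
  define J' where "J' = insert None (Some ` J)"
  define \<Psi> where "\<Psi> k x = (case k of None \<Rightarrow> 1 | Some j \<Rightarrow> \<Phi> j x)" for k x
  define \<C> where "\<C> = {{x \<in> X. 0 < (\<Sum>k\<in>J'. \<theta> k * \<Psi> k x)} |\<theta>. True}"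
  have cJ: "card J \<ge> 1" using J False by (simp add: card_gt_0_iff Suc_le_eq)
  have finJ': "finite J'" and cJ': "card J' = card J + 1"
    using J by (auto simp: J'_def card_image)
  have sumJ': "(\<Sum>k\<in>J'. \<theta> k * \<Psi> k x) = \<theta> None + (\<Sum>j\<in>J. \<theta> (Some j) * \<Phi> j x)" for \<theta> x
    using J by (simp add: J'_def \<Psi>_def sum.reindex)
  have "minimax_rate X n (exp_family X J \<Phi>) \<le> ennreal (109 * min 1 (sqrt ((card J + 1) / n)))"
  proof (rule minimum_distance_estimator[where \<C> = \<C>])
    show "vc_at_most \<C> (card J + 1)"
      unfolding \<C>_def cJ'[symmetric] by (rule vc_positivity_sets[OF finJ'])
    show "{a \<in> X. pmf f a < pmf g a} \<in> \<C>" if fg: "f \<in> exp_family X J \<Phi>" "g \<in> exp_family X J \<Phi>" for f g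
    proof -
      obtain \<theta> where f: "f = gibbs_pmf X (\<lambda>x. \<Sum>j\<in>J. \<theta> j * \<Phi> j x)"
        using fg(1) unfolding exp_family_def by blast
      obtain \<eta> where g: "g = gibbs_pmf X (\<lambda>x. \<Sum>j\<in>J. \<eta> j * \<Phi> j x)"
        using fg(2) unfolding exp_family_def by blast
      define A where "A = (\<Sum>y\<in>X. exp (\<Sum>j\<in>J. \<theta> j * \<Phi> j y))"
      define B where "B = (\<Sum>y\<in>X. exp (\<Sum>j\<in>J. \<eta> j * \<Phi> j y))"
      have AB: "A > 0" "B > 0" unfolding A_def B_def using X by (auto intro!: sum_pos)
      define \<zeta> where "\<zeta> k = (case k of None \<Rightarrow> ln A - ln B | Some j \<Rightarrow> \<eta> j - \<theta> j)" for k
      have "pmf f x < pmf g x \<longleftrightarrow> 0 < (\<Sum>k\<in>J'. \<zeta> k * \<Psi> k x)" if x: "x \<in> X" for x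
      proof -
        let ?a = "\<Sum>j\<in>J. \<theta> j * \<Phi> j x" and ?b = "\<Sum>j\<in>J. \<eta> j * \<Phi> j x"
        have "pmf f x = exp (?a - ln A)" "pmf g x = exp (?b - ln B)"
          using x AB by (simp_all add: f g pmf_gibbs[OF X] exp_diff A_def[symmetric] B_def[symmetric])
        then have "pmf f x < pmf g x \<longleftrightarrow> ?a - ln A < ?b - ln B" by simp
        also have "\<dots> \<longleftrightarrow> 0 < (\<Sum>k\<in>J'. \<zeta> k * \<Psi> k x)"
          by (simp add: sumJ' \<zeta>_def left_diff_distrib sum_subtractf) linarith
        finally show ?thesis .
      qed
      then show ?thesis unfolding \<C>_def by (intro CollectI exI[of _ \<zeta>]) auto
    qed
  qed (use X n in \<open>auto simp: exp_family_def set_gibbs[OF X] \<C>_def\<close>)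
  also have "\<dots> \<le> ennreal (218 * min 1 (sqrt (card J / n)))"
  proof (rule ennreal_leI)
    have "sqrt ((card J + 1) / n) \<le> sqrt (4 * (card J / n))"
      using cJ n by (simp add: divide_right_mono)
    also have "\<dots> = 2 * sqrt (card J / n)" by (subst real_sqrt_mult) simp
    finally show "109 * min 1 (sqrt ((card J + 1) / n)) \<le> 218 * min 1 (sqrt (card J / n))"
      by linarith
  qed
  finally show ?thesis .
qed

section \<open>Polynomials in independent signs\<close>

definition chi :: "'i set \<Rightarrow> ('i \<Rightarrow> real) \<Rightarrow> real" where
  "chi S x = (\<Prod>i\<in>S. x i)"

lemma chi_square: "finite I \<Longrightarrow> S \<subseteq> I \<Longrightarrow> x \<in> signs I \<Longrightarrow> (chi S x)\<^sup>2 = 1"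
  unfolding chi_def prod_power_distrib
  by (intro prod.neutral ballI) (use signsD in fastforce)

lemma abs_chi: "finite I \<Longrightarrow> S \<subseteq> I \<Longrightarrow> x \<in> signs I \<Longrightarrow> \<bar>chi S x\<bar> = 1"
  using chi_square[of I S x] by (simp add: power2_eq_1_iff abs_eq_iff')

lemma chi_orthonormal:
  assumes I: "finite I" "S \<subseteq> I" "T \<subseteq> I"
  shows "avg (signs I) (\<lambda>x. chi S x * chi T x) = (if S = T then 1 else 0)"
proof -
  let ?f = "\<lambda>i y. (if i \<in> S then y else 1) * (if i \<in> T then y else (1::real))"
  have "chi S x * chi T x = (\<Prod>i\<in>I. ?f i (x i))" for x
    using I by (simp add: chi_def prod.distrib prod.inter_restrict[symmetric] Int_absorb1)
  then have "avg (signs I) (\<lambda>x. chi S x * chi T x) = (\<Prod>i\<in>I. (?f i 1 + ?f i (-1)) / 2)"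
    using avg_signs_prod[OF I(1), of ?f] by simp
  also have "\<dots> = (if S = T then 1 else 0)"
  proof (cases "S = T")
    case True
    then show ?thesis by (intro trans[OF prod.neutral]) auto
  next
    case False
    then obtain i where "i \<in> I" "i \<in> S \<longleftrightarrow> i \<notin> T" using I by blast
    then have "(?f i 1 + ?f i (-1)) / 2 = 0" by auto
    with \<open>i \<in> I\<close> I(1) have "(\<Prod>i\<in>I. (?f i 1 + ?f i (-1)) / 2) = 0" by (meson prod_zero)
    with False show ?thesis by simp
  qed
  finally show ?thesis .
qed

lemma parseval:
  assumes I: "finite I" "\<S> \<subseteq> Pow I"
  shows "avg (signs I) (\<lambda>x. (\<Sum>S\<in>\<S>. a S * chi S x)\<^sup>2) = (\<Sum>S\<in>\<S>. (a S)\<^sup>2)"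
proof -
  have fin: "finite \<S>" using I by (meson finite_Pow_iff finite_subset)
  have "avg (signs I) (\<lambda>x. (\<Sum>S\<in>\<S>. a S * chi S x)\<^sup>2)
     = avg (signs I) (\<lambda>x. \<Sum>S\<in>\<S>. \<Sum>T\<in>\<S>. (a S * a T) * (chi S x * chi T x))"
    by (simp add: power2_eq_square sum_product mult_ac)
  also have "\<dots> = (\<Sum>S\<in>\<S>. \<Sum>T\<in>\<S>. (a S * a T) * (if S = T then 1 else 0))"
    unfolding avg_sum avg_cmult using I
    by (intro sum.cong refl arg_cong2[where f = "(*)"] chi_orthonormal) auto
  also have "\<dots> = (\<Sum>S\<in>\<S>. (a S)\<^sup>2)"
    using fin by (simp add: power2_eq_square if_distrib sum.delta cong: if_cong)
  finally show ?thesis .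
qed

lemma avg_signs_insert:
  assumes I: "finite I" "i \<notin> I"
  shows "avg (signs (insert i I)) f
    = (avg (signs I) (\<lambda>x. f (x(i := 1))) + avg (signs I) (\<lambda>x. f (x(i := -1)))) / 2"
proof -
  have "signs (insert i I) = (\<lambda>(y, g). g(i := y)) ` ({-1, 1} \<times> signs I)"
    unfolding signs_def by (rule PiE_insert_eq)
  moreover have "inj_on (\<lambda>(y, g). g(i := y)) ({-1, 1} \<times> signs I)"
    unfolding signs_def by (rule inj_combinator[OF I(2)])
  ultimately have "(\<Sum>x\<in>signs (insert i I). f x) = (\<Sum>(y, g)\<in>{-1, 1} \<times> signs I. f (g(i := y)))"
    by (simp only: sum.reindex) (rule sum.cong, auto)
  also have "\<dots> = (\<Sum>x\<in>signs I. f (x(i := 1))) + (\<Sum>x\<in>signs I. f (x(i := -1)))"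
    by (simp add: sum.cartesian_product[symmetric])
  finally show ?thesis
    using I by (simp add: avg_def card_signs add_divide_distrib)
qed

lemma avg_cauchy_schwarz:
  assumes "finite A"
  shows "(avg A (\<lambda>x. f x * g x))\<^sup>2 \<le> avg A (\<lambda>x. (f x)\<^sup>2) * avg A (\<lambda>x. (g x)\<^sup>2)"
  using Cauchy_Schwarz_ineq_sum[of f g A]
  by (simp add: avg_def power_divide divide_right_mono power2_eq_square[of "real (card A)"])

definition low_sets :: "'i set \<Rightarrow> nat \<Rightarrow> 'i set set" where
  "low_sets I q = {S. S \<subseteq> I \<and> card S \<le> q}"

text \<open>
  Induction on the coordinates. With the coordinate \<open>i\<close> split off, the polynomial is \<open>H + x i * G\<close>
  where \<open>G\<close> has degree one less. Odd powers of \<open>x i\<close> average out, which leaves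
  \<open>H^4 + 6 * G^2 * H^2 + G^4\<close>; the mixed term is controlled by the Cauchy-Schwarz inequality, and the
  factor 9 per degree is exactly what completes the square.
\<close>

lemma bonami:
  assumes "finite I"
  shows "avg (signs I) (\<lambda>x. (\<Sum>S\<in>low_sets I q. a S * chi S x) ^ 4)
    \<le> 9 ^ q * (avg (signs I) (\<lambda>x. (\<Sum>S\<in>low_sets I q. a S * chi S x)\<^sup>2))\<^sup>2"
  using assms
proof (induction I arbitrary: q a rule: finite_induct)
  case empty
  have "low_sets {} q = {{} :: 'a set}" by (auto simp: low_sets_def)
  moreover have "1 * c ^ 4 \<le> 9 ^ q * c ^ 4" for c :: real by (intro mult_right_mono) auto
  ultimately show ?case
    by (simp add: chi_def avg_const finite_signs signs_nonempty power_mult[symmetric])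
next
  case (insert i I)
  note [simp] = finite_signs[OF insert.hyps(1)] signs_nonempty
  show ?case
  proof (cases q)
    case 0
    have "S = {}" if "S \<subseteq> insert i I" "card S = 0" for S
      using that insert.hyps(1) by (metis card_0_eq finite.insertI finite_subset)
    then have "low_sets (insert i I) q = {{}}" by (auto simp: low_sets_def 0)
    then show ?thesis using insert.hyps(1)
      by (simp add: chi_def avg_const finite_signs signs_nonempty power_mult[symmetric] 0)
  next
    case (Suc q')
    define H where "H x = (\<Sum>S\<in>low_sets I q. a S * chi S x)" for x
    define G where "G x = (\<Sum>S\<in>low_sets I q'. a (insert i S) * chi S x)" for x
    have fin: "finite (low_sets I r)" for r using insert.hyps(1) by (simp add: low_sets_def)
    have dec: "low_sets (insert i I) q = low_sets I q \<union> insert i ` low_sets I q'"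
    proof (intro set_eqI iffI)
      fix S assume S: "S \<in> low_sets (insert i I) q"
      show "S \<in> low_sets I q \<union> insert i ` low_sets I q'"
      proof (cases "i \<in> S")
        case True
        have "finite S" using S insert.hyps(1) by (auto simp: low_sets_def intro: finite_subset)
        with True S have "S - {i} \<in> low_sets I q'" "S = insert i (S - {i})"
          by (auto simp: low_sets_def Suc)
        then show ?thesis by blast
      qed (use S in \<open>auto simp: low_sets_def\<close>)
    next
      fix S assume "S \<in> low_sets I q \<union> insert i ` low_sets I q'"
      then show "S \<in> low_sets (insert i I) q"
      proof
        assume "S \<in> insert i ` low_sets I q'"
        then obtain T where T: "T \<subseteq> I" "card T \<le> q'" "S = insert i T" by (auto simp: low_sets_def)
        have "card S \<le> Suc (card T)" unfolding T(3) by (rule card_insert_le_m1[THEN order.trans]) auto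
        then show ?thesis using T by (auto simp: low_sets_def Suc)
      qed (auto simp: low_sets_def)
    qed
    have split: "(\<Sum>S\<in>low_sets (insert i I) q. a S * chi S (x(i := y))) = H x + y * G x" for x y
    proof -
      have chiH: "chi S (x(i := y)) = chi S x" if "S \<in> low_sets I r" for S r
        using that insert.hyps(2) unfolding chi_def by (intro prod.cong) (auto simp: low_sets_def)
      have chiG: "chi (insert i S) (x(i := y)) = y * chi S x" if "S \<in> low_sets I r" for S r
      proof -
        have "finite S" "i \<notin> S" using that insert.hyps by (auto simp: low_sets_def intro: finite_subset)
        then show ?thesis using chiH[OF that] by (simp add: chi_def)
      qed
      have inj: "inj_on (insert i) (low_sets I q')"
      proof (rule inj_onI)
        fix S T assume "S \<in> low_sets I q'" "T \<in> low_sets I q'" "insert i S = insert i T"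
        then show "S = T" using insert.hyps(2)
          by (subst (asm) insert_ident) (auto simp: low_sets_def)
      qed
      have "(\<Sum>S\<in>low_sets (insert i I) q. a S * chi S (x(i := y)))
         = (\<Sum>S\<in>low_sets I q. a S * chi S (x(i := y)))
           + (\<Sum>S\<in>insert i ` low_sets I q'. a S * chi S (x(i := y)))"
        unfolding dec using insert.hyps(2) fin
        by (intro sum.union_disjoint) (auto simp: low_sets_def)
      also have "(\<Sum>S\<in>low_sets I q. a S * chi S (x(i := y))) = H x"
        unfolding H_def by (intro sum.cong) (auto simp: chiH)
      also have "(\<Sum>S\<in>insert i ` low_sets I q'. a S * chi S (x(i := y))) = y * G x"
        unfolding G_def sum.reindex[OF inj] sum_distrib_left
        by (intro sum.cong) (auto simp: chiG)
      finally show ?thesis .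
    qed
    let ?E = "avg (signs I)"
    define A where "A = ?E (\<lambda>x. (G x)\<^sup>2)"
    define B where "B = ?E (\<lambda>x. (H x)\<^sup>2)"
    have AB: "0 \<le> A" "0 \<le> B" by (simp_all add: A_def B_def avg_nonneg)
    have G4: "?E (\<lambda>x. (G x) ^ 4) \<le> 9 ^ q' * A\<^sup>2"
      unfolding A_def G_def by (rule insert.IH)
    have H4: "?E (\<lambda>x. (H x) ^ 4) \<le> 9 ^ q * B\<^sup>2"
      unfolding B_def H_def by (rule insert.IH)
    have cross: "?E (\<lambda>x. (G x)\<^sup>2 * (H x)\<^sup>2) \<le> 3 * 9 ^ q' * (A * B)"
    proof (rule power2_le_imp_le)
      have "(?E (\<lambda>x. (G x)\<^sup>2 * (H x)\<^sup>2))\<^sup>2 \<le> ?E (\<lambda>x. ((G x)\<^sup>2)\<^sup>2) * ?E (\<lambda>x. ((H x)\<^sup>2)\<^sup>2)"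
        by (rule avg_cauchy_schwarz) simp
      also have "\<dots> = ?E (\<lambda>x. (G x) ^ 4) * ?E (\<lambda>x. (H x) ^ 4)" by (simp add: power_mult[symmetric])
      also have "\<dots> \<le> (9 ^ q' * A\<^sup>2) * (9 ^ q * B\<^sup>2)"
        by (intro mult_mono G4 H4) (auto intro!: avg_nonneg)
      also have "\<dots> = (3 * 9 ^ q' * (A * B))\<^sup>2"
        by (simp add: Suc power2_eq_square)
      finally show "(?E (\<lambda>x. (G x)\<^sup>2 * (H x)\<^sup>2))\<^sup>2 \<le> (3 * 9 ^ q' * (A * B))\<^sup>2" .
    qed (use AB in simp)
    let ?f = "\<lambda>x. \<Sum>S\<in>low_sets (insert i I) q. a S * chi S x"
    have "avg (signs (insert i I)) (\<lambda>x. (?f x)\<^sup>2)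
       = (?E (\<lambda>x. (H x + G x)\<^sup>2) + ?E (\<lambda>x. (H x - G x)\<^sup>2)) / 2"
      unfolding avg_signs_insert[OF insert.hyps] split by simp
    also have "\<dots> = ?E (\<lambda>x. 1/2 * ((H x + G x)\<^sup>2 + (H x - G x)\<^sup>2))"
      by (simp only: avg_add avg_cmult)
    also have "\<dots> = ?E (\<lambda>x. (H x)\<^sup>2 + (G x)\<^sup>2)"
      by (intro avg_cong refl) (simp add: power2_eq_square algebra_simps)
    finally have e2: "avg (signs (insert i I)) (\<lambda>x. (?f x)\<^sup>2) = A + B" by (simp add: A_def B_def avg_add)
    have "avg (signs (insert i I)) (\<lambda>x. (?f x) ^ 4)
       = (?E (\<lambda>x. (H x + G x) ^ 4) + ?E (\<lambda>x. (H x - G x) ^ 4)) / 2"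
      unfolding avg_signs_insert[OF insert.hyps] split by simp
    also have "\<dots> = ?E (\<lambda>x. 1/2 * ((H x + G x) ^ 4 + (H x - G x) ^ 4))"
      by (simp only: avg_add avg_cmult)
    also have "\<dots> = ?E (\<lambda>x. (H x) ^ 4 + 6 * ((G x)\<^sup>2 * (H x)\<^sup>2) + (G x) ^ 4)"
      by (intro avg_cong refl) (simp add: power2_eq_square power4_eq_xxxx algebra_simps)
    also have "\<dots> = ?E (\<lambda>x. (H x) ^ 4) + 6 * ?E (\<lambda>x. (G x)\<^sup>2 * (H x)\<^sup>2) + ?E (\<lambda>x. (G x) ^ 4)"
      by (simp only: avg_add avg_cmult)
    also have "\<dots> \<le> 9 ^ q * B\<^sup>2 + 6 * (3 * 9 ^ q' * (A * B)) + 9 ^ q' * A\<^sup>2"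
      using G4 H4 cross by linarith
    also have "\<dots> \<le> 9 ^ q * B\<^sup>2 + 6 * (3 * 9 ^ q' * (A * B)) + 9 ^ q * A\<^sup>2"
      by (intro add_left_mono mult_right_mono) (auto simp: Suc)
    also have "\<dots> = 9 ^ q * (A + B)\<^sup>2"
      by (simp add: Suc power2_eq_square algebra_simps)
    finally show ?thesis unfolding e2 .
  qed
qed

text \<open>
  A function whose fourth moment is comparable with its squared second moment cannot have a small
  first moment, and this remains true after discarding a set of small measure. Instead of the
  inequalities of Hoelder and Cauchy-Schwarz the proof integrates two pointwise polynomial bounds.
\<close>

lemma truncated_L1_lower_bound:
  fixes W :: "'a \<Rightarrow> real"
  assumes X: "finite X" "X \<noteq> {}"
    and m4: "avg X (\<lambda>x. W x ^ 4) \<le> 81 * (avg X (\<lambda>x. (W x)\<^sup>2))\<^sup>2"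
    and bad: "avg X (\<lambda>x. if P x then 1 else 0) \<le> 1 / 324"
  shows "sqrt (avg X (\<lambda>x. (W x)\<^sup>2)) / 28 \<le> avg X (\<lambda>x. if P x then 0 else \<bar>W x\<bar>)"
proof -
  define v where "v = avg X (\<lambda>x. (W x)\<^sup>2)"
  define s where "s = sqrt v"
  have v0: "0 \<le> v" by (simp add: v_def avg_nonneg)
  show ?thesis
  proof (cases "v = 0")
    case True
    then show ?thesis by (simp add: v_def[symmetric] avg_nonneg)
  next
    case False
    with v0 have v: "0 < v" by simp
    then have s: "0 < s" "v = s\<^sup>2" by (simp_all add: s_def)
    \<comment> \<open>any multiple of the standard deviation \<open>s\<close> by a factor above \<open>sqrt 24\<close> gives a positive bound\<close>
    define t where "t = 7 * s"
    have t: "0 < t" using s by (simp add: t_def)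
    have cubic: "w\<^sup>2 / t - 4/27 * (w ^ 4 / t ^ 3) \<le> \<bar>w\<bar>" for w :: real
    proof -
      define u where "u = \<bar>w\<bar> / t"
      have u: "0 \<le> u" "\<bar>w\<bar> = t * u" using t by (simp_all add: u_def)
      have "w\<^sup>2 = (t * u)\<^sup>2" "w ^ 4 = (t * u) ^ 4" using u(2) by (metis power2_abs, metis power_even_abs_numeral even_numeral)
      then have "\<bar>w\<bar> - (w\<^sup>2 / t - 4/27 * (w ^ 4 / t ^ 3)) = t * (u * ((1 + u / 3) * (1 - 2 * u / 3)\<^sup>2))"
        using t u by (simp add: field_simps power2_eq_square power3_eq_cube power4_eq_xxxx)
      moreover have "0 \<le> t * (u * ((1 + u / 3) * (1 - 2 * u / 3)\<^sup>2))" using t u by simp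
      ultimately show ?thesis by linarith
    qed
    have split: "w\<^sup>2 \<le> w ^ 4 / (324 * v) + 81 * v" for w :: real
    proof -
      have "0 \<le> (w\<^sup>2 - 162 * v)\<^sup>2 / (324 * v)" using v by simp
      also have "\<dots> = w ^ 4 / (324 * v) + 81 * v - w\<^sup>2"
        using v by (simp add: field_simps power2_eq_square power4_eq_xxxx)
      finally show ?thesis by simp
    qed
    have pt: "(W x)\<^sup>2 * (1 / t) + W x ^ 4 * (- (4/27) / t ^ 3) + W x ^ 4 * (- 1 / (324 * v * t))
        + (if P x then 1 else 0) * (- 81 * v / t) \<le> (if P x then 0 else \<bar>W x\<bar>)" for x
    proof (cases "P x")
      case True
      have "(W x)\<^sup>2 * (1 / t) \<le> (W x ^ 4 / (324 * v) + 81 * v) * (1 / t)"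
        using split t by (intro mult_right_mono) auto
      moreover have "0 \<le> W x ^ 4 * ((4/27) / t ^ 3)" using t by simp
      ultimately show ?thesis using True by (simp add: algebra_simps add_divide_distrib)
    next
      case False
      have "0 \<le> W x ^ 4 * (1 / (324 * v * t))" using t v by simp
      with cubic[of "W x"] show ?thesis using False by simp
    qed
    let ?E = "avg X"
    have "?E (\<lambda>x. (W x)\<^sup>2 * (1 / t) + W x ^ 4 * (- (4/27) / t ^ 3) + W x ^ 4 * (- 1 / (324 * v * t))
        + (if P x then 1 else 0) * (- 81 * v / t)) \<le> ?E (\<lambda>x. if P x then 0 else \<bar>W x\<bar>)"
      by (rule avg_mono[OF pt])
    then have "v * (1 / t) + ?E (\<lambda>x. W x ^ 4) * (- (4/27) / t ^ 3)
       + ?E (\<lambda>x. W x ^ 4) * (- 1 / (324 * v * t)) + ?E (\<lambda>x. if P x then 1 else 0) * (- 81 * v / t)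
       \<le> ?E (\<lambda>x. if P x then 0 else \<bar>W x\<bar>)"
      unfolding avg_add avg_multc v_def[symmetric] .
    moreover have "81 * v\<^sup>2 * (- (4/27) / t ^ 3) \<le> ?E (\<lambda>x. W x ^ 4) * (- (4/27) / t ^ 3)"
      using m4 t unfolding v_def[symmetric] by (intro mult_right_mono_neg) auto
    moreover have "81 * v\<^sup>2 * (- 1 / (324 * v * t)) \<le> ?E (\<lambda>x. W x ^ 4) * (- 1 / (324 * v * t))"
      using m4 t v unfolding v_def[symmetric] by (intro mult_right_mono_neg) auto
    moreover have "1 / 324 * (- 81 * v / t) \<le> ?E (\<lambda>x. if P x then 1 else 0) * (- 81 * v / t)"
      using bad t v by (intro mult_right_mono_neg) auto
    ultimately have "v * (1 / t) + 81 * v\<^sup>2 * (- (4/27) / t ^ 3)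
       + 81 * v\<^sup>2 * (- 1 / (324 * v * t)) + 1 / 324 * (- 81 * v / t)
       \<le> ?E (\<lambda>x. if P x then 0 else \<bar>W x\<bar>)" by linarith
    moreover have "v * (1 / t) + 81 * v\<^sup>2 * (- (4/27) / t ^ 3)
       + 81 * v\<^sup>2 * (- 1 / (324 * v * t)) + 1 / 324 * (- 81 * v / t) = (1/14 - 12/343) * s"
      using s(1) unfolding t_def s(2) by (simp add: field_simps power2_eq_square power3_eq_cube)
    moreover have "s / 28 \<le> (1/14 - 12/343) * s" using s(1) by simp
    ultimately have "s / 28 \<le> ?E (\<lambda>x. if P x then 0 else \<bar>W x\<bar>)" by linarith
    then show ?thesis by (simp only: s_def v_def)
  qed
qed

section \<open>Assouad's lemma with exceptional hypotheses\<close>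

definition hamming :: "'j set \<Rightarrow> ('j \<Rightarrow> real) \<Rightarrow> ('j \<Rightarrow> real) \<Rightarrow> nat" where
  "hamming J s r = card {j \<in> J. s j \<noteq> r j}"

lemma hamming_le: "finite J \<Longrightarrow> hamming J s r \<le> card J"
  unfolding hamming_def by (rule card_mono) auto

lemma hamming_eq_sum: "finite J \<Longrightarrow> real (hamming J s r) = (\<Sum>j\<in>J. if s j \<noteq> r j then 1 else 0)"
  by (simp add: hamming_def sum.inter_filter[symmetric])

lemma tv_dist_triangle: "tv_dist X f h \<le> tv_dist X g f + tv_dist X g h"
proof -
  have "(\<Sum>x\<in>X. \<bar>f x - h x\<bar>) \<le> (\<Sum>x\<in>X. \<bar>g x - f x\<bar> + \<bar>g x - h x\<bar>)"
    by (intro sum_mono) linarith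
  then show ?thesis by (simp add: tv_dist_def sum.distrib)
qed

definition flip :: "'j \<Rightarrow> ('j \<Rightarrow> real) \<Rightarrow> ('j \<Rightarrow> real)" where
  "flip j s = s(j := - s j)"

lemma flip_in_signs: "j \<in> J \<Longrightarrow> s \<in> signs J \<Longrightarrow> flip j s \<in> signs J"
  by (auto simp: flip_def signs_def PiE_iff extensional_def)

lemma flip_flip: "flip j (flip j s) = s"
  by (simp add: flip_def)

lemma sum_flip: "j \<in> J \<Longrightarrow> (\<Sum>s\<in>signs J. f (flip j s)) = (\<Sum>s\<in>signs J. f s)"
  by (rule sum.reindex_bij_witness[where i = "flip j" and j = "flip j"])
     (auto simp: flip_flip flip_in_signs)

text \<open>
  The estimate \<open>g\<close> is decoded to the nearest good hypothesis \<open>b\<close>. For a good \<open>s\<close> the loss is at least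
  half the distance between \<open>p s\<close> and \<open>p b\<close>, hence at least \<open>\<kappa> / 2\<close> times the number of wrong signs; for a
  bad \<open>s\<close> the loss is at least 0, and the excess is charged to it. Of two sign vectors that differ only
  at \<open>j\<close>, the decoder is wrong at \<open>j\<close> for one of them. The inequality is stated
  for a fixed output \<open>g\<close>, so that later only the loss is integrated, and not the decoder.
\<close>

lemma assouad_pointwise:
  fixes w :: "('j \<Rightarrow> real) \<Rightarrow> real" and p :: "('j \<Rightarrow> real) \<Rightarrow> 'a \<Rightarrow> real" and \<kappa> :: real
  assumes J: "finite J" and G: "G \<subseteq> signs J" "G \<noteq> {}"
    and w: "\<And>s. s \<in> signs J \<Longrightarrow> 0 \<le> w s" and \<kappa>: "0 \<le> \<kappa>"
    and sep: "\<And>s r. s \<in> G \<Longrightarrow> r \<in> G \<Longrightarrow> \<kappa> * hamming J s r \<le> tv_dist X (p s) (p r)"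
  shows "\<kappa> / 2 * ((\<Sum>j\<in>J. \<Sum>s\<in>signs J. min (w s) (w (flip j s)) / 2) - card J * (\<Sum>s\<in>signs J - G. w s))
    \<le> (\<Sum>s\<in>signs J. w s * tv_dist X g (p s))"
proof -
  have fin: "finite (signs J)" using J by (rule finite_signs)
  obtain b where b: "b \<in> G" "\<And>s. s \<in> G \<Longrightarrow> tv_dist X g (p b) \<le> tv_dist X g (p s)"
  proof -
    have "finite ((\<lambda>s. tv_dist X g (p s)) ` G)" using G fin by (meson finite_imageI finite_subset)
    then have "Min ((\<lambda>s. tv_dist X g (p s)) ` G) \<in> (\<lambda>s. tv_dist X g (p s)) ` G"
      using G by (intro Min_in) auto
    then obtain b where "b \<in> G" "tv_dist X g (p b) = Min ((\<lambda>s. tv_dist X g (p s)) ` G)" by force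
    then show ?thesis using \<open>finite ((\<lambda>s. tv_dist X g (p s)) ` G)\<close> by (intro that[of b]) auto
  qed
  have tv0: "0 \<le> tv_dist X g f" for f by (simp add: tv_dist_def sum_nonneg)
  have pt: "\<kappa> / 2 * (hamming J s b - (if s \<in> G then 0 else real (card J))) \<le> tv_dist X g (p s)" for s
  proof (cases "s \<in> G")
    case True
    have "\<kappa> * hamming J s b \<le> tv_dist X (p s) (p b)" using sep True b by blast
    also have "\<dots> \<le> tv_dist X g (p s) + tv_dist X g (p b)" by (rule tv_dist_triangle)
    also have "\<dots> \<le> 2 * tv_dist X g (p s)" using b(2)[OF True] by simp
    finally show ?thesis using True by simp
  next
    case False
    have "\<kappa> / 2 * (hamming J s b - real (card J)) \<le> 0"
      using hamming_le[OF J, of s b] \<kappa> by (intro mult_nonneg_nonpos) auto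
    then show ?thesis using False tv0[of "p s"] by simp
  qed
  have half: "(\<Sum>s\<in>signs J. min (w s) (w (flip j s)) / 2)
      \<le> (\<Sum>s\<in>signs J. w s * (if s j \<noteq> b j then 1 else 0))" if j: "j \<in> J" for j
  proof -
    let ?e = "\<lambda>s. w s * (if s j \<noteq> b j then 1 else (0::real))"
    have "(\<Sum>s\<in>signs J. min (w s) (w (flip j s))) \<le> (\<Sum>s\<in>signs J. ?e s + ?e (flip j s))"
    proof (rule sum_mono)
      fix s assume s: "s \<in> signs J"
      have "s j \<noteq> b j \<or> flip j s j \<noteq> b j"
        using signsD[OF s j] by (auto simp: flip_def)
      then show "min (w s) (w (flip j s)) \<le> ?e s + ?e (flip j s)"
        using w[OF s] w[OF flip_in_signs[OF j s]] by (auto simp: min_def)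
    qed
    also have "\<dots> = 2 * (\<Sum>s\<in>signs J. ?e s)"
      using sum_flip[OF j, of ?e] by (simp add: sum.distrib)
    finally show ?thesis by (simp add: sum_divide_distrib[symmetric])
  qed
  have "(\<Sum>j\<in>J. \<Sum>s\<in>signs J. min (w s) (w (flip j s)) / 2)
      \<le> (\<Sum>j\<in>J. \<Sum>s\<in>signs J. w s * (if s j \<noteq> b j then 1 else 0))"
    by (intro sum_mono half)
  also have "\<dots> = (\<Sum>s\<in>signs J. w s * hamming J s b)"
    by (subst sum.swap) (simp add: hamming_eq_sum[OF J] sum_distrib_left)
  finally have ham: "(\<Sum>j\<in>J. \<Sum>s\<in>signs J. min (w s) (w (flip j s)) / 2)
      \<le> (\<Sum>s\<in>signs J. w s * hamming J s b)" .
  have badsum: "(\<Sum>s\<in>signs J. w s * (if s \<in> G then 0 else real (card J)))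
      = card J * (\<Sum>s\<in>signs J - G. w s)"
  proof -
    have "(\<Sum>s\<in>signs J. w s * (if s \<in> G then 0 else real (card J)))
       = (\<Sum>s\<in>signs J - G. w s * card J)"
      using fin by (intro sum.mono_neutral_cong_right) auto
    then show ?thesis by (simp add: sum_distrib_left mult.commute)
  qed
  have "\<kappa> / 2 * ((\<Sum>j\<in>J. \<Sum>s\<in>signs J. min (w s) (w (flip j s)) / 2) - card J * (\<Sum>s\<in>signs J - G. w s))
      \<le> \<kappa> / 2 * ((\<Sum>s\<in>signs J. w s * hamming J s b) - card J * (\<Sum>s\<in>signs J - G. w s))"
    using ham \<kappa> by (intro mult_left_mono) auto
  also have "\<dots> = (\<Sum>s\<in>signs J. w s * (\<kappa> / 2 * (hamming J s b - (if s \<in> G then 0 else real (card J)))))"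
    unfolding badsum[symmetric] unfolding sum_subtractf[symmetric] sum_distrib_left
    by (intro sum.cong) (auto simp: algebra_simps)
  also have "\<dots> \<le> (\<Sum>s\<in>signs J. w s * tv_dist X g (p s))"
    by (intro sum_mono mult_left_mono pt w)
  finally show ?thesis .
qed

text \<open>
  The worst risk dominates the average over finitely many hypotheses. A lower bound that holds for
  every output of the estimator survives integration over the kernel.
\<close>

lemma risk_ge_average:
  fixes p :: "'s \<Rightarrow> 'a pmf"
  assumes X: "finite X" "\<And>f. f \<in> F \<Longrightarrow> set_pmf f \<subseteq> X"
    and S: "finite S" "S \<noteq> {}" "\<And>s. s \<in> S \<Longrightarrow> p s \<in> F"
    and K: "K \<in> estimators X n"
    and LB: "\<And>x g. x \<in> samples X n \<Longrightarrow>
      LB x \<le> (\<Sum>s\<in>S. likelihood (pmf (p s)) n x * tv_dist X g (pmf (p s)))"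
  shows "ennreal (\<Sum>x\<in>samples X n. LB x) \<le> ennreal (card S) * risk X n K F"
proof -
  let ?M = "\<Pi>\<^sub>M x\<in>X. (borel :: real measure)"
  let ?tv = "\<lambda>s g. tv_dist X g (pmf (p s))"
  let ?w = "\<lambda>s x. likelihood (pmf (p s)) n x"
  have w0: "0 \<le> ?w s x" for s x by (simp add: likelihood_def prod_nonneg)
  have tv0: "0 \<le> ?tv s g" for s g by (simp add: tv_dist_def sum_nonneg)
  have Kx: "prob_space (K (map x [0..<n]))" "sets (K (map x [0..<n])) = sets ?M"
    if x: "x \<in> samples X n" for x
  proof -
    have "map x [0..<n] \<in> {xs. set xs \<subseteq> X \<and> length xs = n}" using samplesD[OF x] by auto
    then have "K (map x [0..<n]) \<in> space (prob_algebra ?M)"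
      using K unfolding estimators_def measurable_count_space_eq1 by blast
    then show "prob_space (K (map x [0..<n]))" "sets (K (map x [0..<n])) = sets ?M"
      by (simp_all add: space_prob_algebra)
  qed
  have "ennreal (\<Sum>x\<in>samples X n. LB x) \<le> ennreal (\<Sum>x\<in>samples X n. max 0 (LB x))"
    by (intro ennreal_leI sum_mono) simp
  also have "\<dots> = (\<Sum>x\<in>samples X n. ennreal (max 0 (LB x)))"
    by (rule sum_ennreal[symmetric]) simp
  also have "\<dots> \<le> (\<Sum>x\<in>samples X n. \<Sum>s\<in>S. ennreal (?w s x) * (\<integral>\<^sup>+ g. ennreal (?tv s g) \<partial>K (map x [0..<n])))"
  proof (rule sum_mono)
    fix x assume x: "x \<in> samples X n"
    let ?K = "K (map x [0..<n])"
    interpret prob_space ?K by (rule Kx[OF x])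
    have meas: "(\<lambda>g. ennreal (?tv s g)) \<in> borel_measurable ?K" for s
      unfolding measurable_cong_sets[OF Kx(2)[OF x] refl] by (rule measurable_tv_dist[OF X(1)])
    have "ennreal (max 0 (LB x)) = (\<integral>\<^sup>+ g. ennreal (max 0 (LB x)) \<partial>?K)"
      by (simp add: emeasure_space_1)
    also have "\<dots> \<le> (\<integral>\<^sup>+ g. (\<Sum>s\<in>S. ennreal (?w s x) * ennreal (?tv s g)) \<partial>?K)"
    proof (rule nn_integral_mono)
      fix g
      have "ennreal (max 0 (LB x)) \<le> ennreal (\<Sum>s\<in>S. ?w s x * ?tv s g)"
        using LB[OF x, of g] w0 tv0 by (intro ennreal_leI) (auto intro!: sum_nonneg mult_nonneg_nonneg)
      also have "\<dots> = (\<Sum>s\<in>S. ennreal (?w s x * ?tv s g))"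
        using w0 tv0 by (intro sum_ennreal[symmetric]) auto
      also have "\<dots> = (\<Sum>s\<in>S. ennreal (?w s x) * ennreal (?tv s g))"
        using w0 tv0 by (simp add: ennreal_mult)
      finally show "ennreal (max 0 (LB x)) \<le> (\<Sum>s\<in>S. ennreal (?w s x) * ennreal (?tv s g))" .
    qed
    also have "\<dots> = (\<Sum>s\<in>S. \<integral>\<^sup>+ g. ennreal (?w s x) * ennreal (?tv s g) \<partial>?K)"
      using meas by (intro nn_integral_sum) auto
    also have "\<dots> = (\<Sum>s\<in>S. ennreal (?w s x) * (\<integral>\<^sup>+ g. ennreal (?tv s g) \<partial>?K))"
      using meas by (intro sum.cong refl nn_integral_cmult)
    finally show "ennreal (max 0 (LB x)) \<le> (\<Sum>s\<in>S. ennreal (?w s x) * (\<integral>\<^sup>+ g. ennreal (?tv s g) \<partial>?K))" .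
  qed
  also have "\<dots> = (\<Sum>s\<in>S. \<Sum>x\<in>samples X n. ennreal (?w s x) * (\<integral>\<^sup>+ g. ennreal (?tv s g) \<partial>K (map x [0..<n])))"
    by (rule sum.swap)
  also have "\<dots> \<le> (\<Sum>s\<in>S. risk X n K F)"
  proof (rule sum_mono)
    fix s assume s: "s \<in> S"
    have eq: "risk X n K F = (SUP f\<in>F. \<Sum>x\<in>samples X n. ennreal (likelihood (pmf f) n x) *
           (\<integral>\<^sup>+ g. ennreal (tv_dist X g (pmf f)) \<partial>K (map x [0..<n])))"
      by (rule risk_eq_sum[OF X])
    show "(\<Sum>x\<in>samples X n. ennreal (?w s x) * (\<integral>\<^sup>+ g. ennreal (?tv s g) \<partial>K (map x [0..<n]))) \<le> risk X n K F"
      unfolding eq by (rule SUP_upper2[OF S(3)[OF s]]) simp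
  qed
  also have "\<dots> = ennreal (card S) * risk X n K F" by (simp add: ennreal_of_nat_eq_real_of_nat)
  finally show ?thesis .
qed

text \<open>
  The bad hypotheses are at most one sixteenth of all, so their charge \<open>card J / 16\<close> takes away only
  half of the \<open>card J / 8\<close> wrong signs that are unavoidable on average.
\<close>

theorem assouad:
  fixes p :: "('j \<Rightarrow> real) \<Rightarrow> 'a pmf" and \<kappa> :: real
  assumes X: "finite X" "\<And>f. f \<in> F \<Longrightarrow> set_pmf f \<subseteq> X"
    and J: "finite J" and p: "\<And>s. s \<in> signs J \<Longrightarrow> p s \<in> F" and \<kappa>: "0 \<le> \<kappa>"
    and G: "G \<subseteq> signs J" "16 * card (signs J - G) \<le> card (signs J)"
    and sep: "\<And>s r. s \<in> G \<Longrightarrow> r \<in> G \<Longrightarrow> \<kappa> * hamming J s r \<le> tv_dist X (pmf (p s)) (pmf (p r))"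
    and close: "\<And>s j. s \<in> signs J \<Longrightarrow> j \<in> J \<Longrightarrow>
      1 / 4 \<le> (\<Sum>x\<in>samples X n. min (likelihood (pmf (p s)) n x) (likelihood (pmf (p (flip j s))) n x))"
  shows "ennreal (\<kappa> * card J / 32) \<le> minimax_rate X n F"
  unfolding minimax_rate_def
proof (rule INF_greatest)
  fix K assume K: "K \<in> estimators X n"
  let ?w = "\<lambda>x s. likelihood (pmf (p s)) n x"
  let ?S = "samples X n"
  define N where "N = card (signs J)"
  have fin: "finite (signs J)" using J by (rule finite_signs)
  have N: "0 < N" using fin signs_nonempty by (simp add: N_def card_gt_0_iff)
  have Gne: "G \<noteq> {}" using G(2) N by (auto simp: N_def)
  define LB where "LB x = \<kappa> / 2 * ((\<Sum>j\<in>J. \<Sum>s\<in>signs J. min (?w x s) (?w x (flip j s)) / 2)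
      - card J * (\<Sum>s\<in>signs J - G. ?w x s))" for x
  have one: "(\<Sum>x\<in>?S. ?w x s) = 1" if "s \<in> signs J" for s
    using X p[OF that] sum_pmf_eq_1[of X "p s"] by (simp add: sum_likelihood_prod)
  have "\<kappa> * card J / 32 * N \<le> (\<Sum>x\<in>?S. LB x)"
  proof -
    have "card J * (N * (1 / 8)) = (\<Sum>j\<in>J. \<Sum>s\<in>signs J. 1 / 4 / (2::real))"
      by (simp add: N_def)
    also have "\<dots> \<le> (\<Sum>j\<in>J. \<Sum>s\<in>signs J. (\<Sum>x\<in>?S. min (?w x s) (?w x (flip j s))) / 2)"
      by (intro sum_mono divide_right_mono close) auto
    also have "\<dots> = (\<Sum>x\<in>?S. \<Sum>j\<in>J. \<Sum>s\<in>signs J. min (?w x s) (?w x (flip j s)) / 2)"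
      by (simp add: sum_divide_distrib sum.swap[of _ ?S])
    finally have 1: "card J * (N * (1 / 8)) \<le> (\<Sum>x\<in>?S. \<Sum>j\<in>J. \<Sum>s\<in>signs J. min (?w x s) (?w x (flip j s)) / 2)" .
    have "(\<Sum>x\<in>?S. \<Sum>s\<in>signs J - G. ?w x s) = card (signs J - G)"
      by (subst sum.swap) (simp add: one)
    also have "\<dots> \<le> N / 16" using G(2) by (simp add: N_def)
    finally have 2: "card J * (\<Sum>x\<in>?S. \<Sum>s\<in>signs J - G. ?w x s) \<le> card J * (N / 16)"
      by (intro mult_left_mono) auto
    have "\<kappa> * card J / 32 * N = \<kappa> / 2 * (card J * (N * (1 / 8)) - card J * (N / 16))"
      by (simp add: algebra_simps)
    also have "\<dots> \<le> \<kappa> / 2 * ((\<Sum>x\<in>?S. \<Sum>j\<in>J. \<Sum>s\<in>signs J. min (?w x s) (?w x (flip j s)) / 2)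
        - card J * (\<Sum>x\<in>?S. \<Sum>s\<in>signs J - G. ?w x s))"
      by (intro mult_left_mono diff_mono 1 2) (use \<kappa> in simp)
    also have "\<dots> = (\<Sum>x\<in>?S. LB x)"
      by (simp add: LB_def sum_distrib_left sum_subtractf right_diff_distrib)
    finally show ?thesis .
  qed
  then have "ennreal (\<kappa> * card J / 32 * N) \<le> ennreal (\<Sum>x\<in>?S. LB x)" by (rule ennreal_leI)
  also have "\<dots> \<le> ennreal (card (signs J)) * risk X n K F"
  proof (rule risk_ge_average[OF X fin signs_nonempty p K])
    fix x g
    show "LB x \<le> (\<Sum>s\<in>signs J. ?w x s * tv_dist X g (pmf (p s)))"
      unfolding LB_def using sep \<kappa>
      by (intro assouad_pointwise[OF J G(1) Gne]) (auto simp: likelihood_def prod_nonneg)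
  qed
  finally have "ennreal N * ennreal (\<kappa> * card J / 32) \<le> ennreal N * risk X n K F"
    using \<kappa> by (simp add: N_def ennreal_mult[symmetric] mult.commute)
  then show "ennreal (\<kappa> * card J / 32) \<le> risk X n K F"
    using N by (subst (asm) ennreal_mult_le_mult_iff) auto
qed

section \<open>Hellinger affinity\<close>

lemma prod_sqrt: "(\<Prod>i\<in>A. sqrt (f i)) = sqrt (\<Prod>i\<in>A. f i)"
  by (induction A rule: infinite_finite_induct) (simp_all add: real_sqrt_mult)

text \<open>
  The Hellinger affinity of the laws of \<open>n\<close> samples is the \<open>n\<close>-th power of that of one sample, and
  it is at most the overlap plus one half since \<open>sqrt (a * b) \<le> min a b + max a b / 4\<close>.
\<close>

lemma hellinger_two_point:
  fixes p q :: "'a \<Rightarrow> real"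
  assumes X: "finite X" and p: "\<And>x. x \<in> X \<Longrightarrow> 0 \<le> p x" "(\<Sum>x\<in>X. p x) = 1"
    and q: "\<And>x. x \<in> X \<Longrightarrow> 0 \<le> q x" "(\<Sum>x\<in>X. q x) = 1"
  shows "(\<Sum>x\<in>X. sqrt (p x * q x)) ^ n - 1 / 2
    \<le> (\<Sum>x\<in>samples X n. min (likelihood p n x) (likelihood q n x))"
proof -
  let ?S = "samples X n" and ?P = "likelihood p n" and ?Q = "likelihood q n"
  have nn: "0 \<le> ?P x" "0 \<le> ?Q x" if "x \<in> ?S" for x
    using that likelihood_nonneg[of X] p(1) q(1) by blast+
  have amgm: "sqrt (a * b) \<le> min a b + (a + b) / 4" if "0 \<le> a" "0 \<le> b" for a b :: real
  proof (rule real_le_lsqrt)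
    show "0 \<le> min a b + (a + b) / 4" using that by simp
    have "a * b = min a b * max a b" by (simp add: min_def max_def)
    also have "\<dots> \<le> (min a b + max a b / 4)\<^sup>2"
      using zero_le_power2[of "min a b - max a b / 4"] by (simp add: power2_eq_square algebra_simps)
    also have "\<dots> \<le> (min a b + (a + b) / 4)\<^sup>2"
      using that by (intro power_mono) auto
    finally show "a * b \<le> (min a b + (a + b) / 4)\<^sup>2" .
  qed
  have "(\<Sum>x\<in>X. sqrt (p x * q x)) ^ n = (\<Sum>x\<in>?S. likelihood (\<lambda>a. sqrt (p a * q a)) n x)"
    by (rule sum_likelihood_prod[OF X, symmetric])
  also have "\<dots> = (\<Sum>x\<in>?S. sqrt (?P x * ?Q x))"
    by (simp only: likelihood_def prod.distrib[symmetric] prod_sqrt)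
  also have "\<dots> \<le> (\<Sum>x\<in>?S. min (?P x) (?Q x) + (?P x + ?Q x) / 4)"
    by (intro sum_mono amgm nn)
  also have "\<dots> = (\<Sum>x\<in>?S. min (?P x) (?Q x)) + 1 / 2"
    by (simp add: sum.distrib sum_divide_distrib[symmetric] sum_likelihood_prod[OF X] p q)
  finally show ?thesis by simp
qed

text \<open>
  The affinity is \<open>1 - \<Sum>x. (sqrt (p x) - sqrt (q x))^2 / 2\<close>, and the two square roots differ by the
  factor \<open>exp (u x / 2)\<close>.
\<close>

lemma hellinger_affinity_bound:
  fixes p :: "'a \<Rightarrow> real"
  assumes X: "finite X" and p: "\<And>x. x \<in> X \<Longrightarrow> 0 \<le> p x" "(\<Sum>x\<in>X. p x) = 1"
    and q1: "(\<Sum>x\<in>X. q x) = 1"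
    and q: "\<And>x. x \<in> X \<Longrightarrow> q x = p x * exp (u x)" "\<And>x. x \<in> X \<Longrightarrow> \<bar>u x\<bar> \<le> \<eta>" and \<eta>: "\<eta> \<le> 1"
  shows "1 - \<eta>\<^sup>2 / 2 \<le> (\<Sum>x\<in>X. sqrt (p x * q x))"
proof -
  have pt: "(p x + q x) / 2 - p x * (\<eta>\<^sup>2 / 2) \<le> sqrt (p x * q x)" if x: "x \<in> X" for x
  proof -
    have eq: "sqrt (p x * q x) = p x * exp (u x / 2)"
    proof (rule real_sqrt_unique)
      show "(p x * exp (u x / 2))\<^sup>2 = p x * q x"
        using q(1)[OF x] by (simp add: power2_eq_square exp_add[symmetric])
    qed (use p(1)[OF x] in simp)
    have "\<bar>exp (u x / 2) - 1\<bar> \<le> 2 * \<bar>u x / 2\<bar>"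
    proof -
      have "\<bar>u x / 2\<bar> \<le> 1 / 2" using q(2)[OF x] \<eta> by simp
      then have "exp (u x / 2) \<le> 1 + 2 * \<bar>u x / 2\<bar>" using exp_bound_lemma[of "u x / 2"] by simp
      moreover have "1 + u x / 2 \<le> exp (u x / 2)" by (rule exp_ge_add_one_self)
      ultimately show ?thesis by linarith
    qed
    also have "\<dots> \<le> \<eta>" using q(2)[OF x] by simp
    finally have "(exp (u x / 2) - 1)\<^sup>2 \<le> \<eta>\<^sup>2"
      by (metis abs_ge_zero power2_abs power_mono)
    moreover have "(exp (u x / 2) - 1)\<^sup>2 = exp (u x) - 2 * exp (u x / 2) + 1"
      by (simp add: power2_eq_square algebra_simps exp_add[symmetric])
    ultimately have "(1 + exp (u x)) / 2 - \<eta>\<^sup>2 / 2 \<le> exp (u x / 2)" by (simp add: field_simps)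
    from mult_left_mono[OF this p(1)[OF x]] show ?thesis
      unfolding eq unfolding q(1)[OF x] by (simp add: algebra_simps add_divide_distrib)
  qed
  have "1 - \<eta>\<^sup>2 / 2 = (\<Sum>x\<in>X. (p x + q x) / 2 - p x * (\<eta>\<^sup>2 / 2))"
    by (simp add: sum_subtractf sum_divide_distrib[symmetric] sum.distrib sum_distrib_right[symmetric] p q1)
  also have "\<dots> \<le> (\<Sum>x\<in>X. sqrt (p x * q x))" by (rule sum_mono[OF pt])
  finally show ?thesis .
qed

section \<open>Gibbs measures with small random interactions\<close>

definition energy :: "'i set set \<Rightarrow> real \<Rightarrow> ('i set \<Rightarrow> real) \<Rightarrow> ('i \<Rightarrow> real) \<Rightarrow> real" where
  "energy J \<delta> s x = (\<Sum>S\<in>J. (\<delta> * s S) * chi S x)"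

text \<open>
  The normalizing sum divided by the number of spin configurations, so that it equals 1 without
  interactions.
\<close>

definition mean_weight :: "'i set \<Rightarrow> 'i set set \<Rightarrow> real \<Rightarrow> ('i set \<Rightarrow> real) \<Rightarrow> real" where
  "mean_weight I J \<delta> s = avg (signs I) (\<lambda>x. exp (energy J \<delta> s x))"

lemma pmf_gibbs_energy:
  fixes \<delta> :: real
  assumes I: "finite I" and x: "x \<in> signs I"
  shows "pmf (gibbs_pmf (signs I) (energy J \<delta> s)) x
    = exp (energy J \<delta> s x - ln (mean_weight I J \<delta> s)) / card (signs I)"
proof -
  have N: "0 < card (signs I)" using I by (simp add: card_signs)
  have Z: "(\<Sum>y\<in>signs I. exp (energy J \<delta> s y)) = card (signs I) * mean_weight I J \<delta> s"
    using N by (simp add: mean_weight_def avg_def)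
  have "0 < (\<Sum>y\<in>signs I. exp (energy J \<delta> s y))"
    using I by (intro sum_pos) (auto simp: finite_signs signs_nonempty)
  then have "0 < mean_weight I J \<delta> s" using N unfolding Z by (simp add: zero_less_mult_iff)
  then show ?thesis
    using I x by (simp add: pmf_gibbs finite_signs signs_nonempty Z exp_diff field_simps)
qed

lemma avg_energy_square:
  fixes \<delta> :: real
  assumes I: "finite I" "J \<subseteq> Pow I" and s: "s \<in> signs J"
  shows "avg (signs I) (\<lambda>x. (energy J \<delta> s x)\<^sup>2) = card J * \<delta>\<^sup>2"
proof -
  have "(\<delta> * s S)\<^sup>2 = \<delta>\<^sup>2" if "S \<in> J" for S
    using signsD[OF s that] by auto
  then show ?thesis unfolding energy_def parseval[OF I] by simp
qed

text \<open>
  Jensen's inequality: nontrivial characters have mean 0, hence so has the energy.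
\<close>

lemma mean_weight_ge_1:
  fixes \<delta> :: real
  assumes I: "finite I" "J \<subseteq> Pow I" "{} \<notin> J"
  shows "1 \<le> mean_weight I J \<delta> s"
proof -
  have "avg (signs I) (chi S) = 0" if S: "S \<in> J" for S
  proof -
    have "avg (signs I) (chi S) = avg (signs I) (\<lambda>x. chi S x * chi {} x)"
      by (intro avg_cong refl) (simp add: chi_def)
    also have "\<dots> = (if S = {} then 1 else 0)"
      using S I by (intro chi_orthonormal) auto
    finally show ?thesis using S I(3) by (cases "S = {}") auto
  qed
  then have 0: "avg (signs I) (\<lambda>x. energy J \<delta> s x) = 0"
    unfolding energy_def avg_sum avg_cmult by simp
  have "avg (signs I) (\<lambda>x. 1 + energy J \<delta> s x) \<le> mean_weight I J \<delta> s"
    unfolding mean_weight_def by (intro avg_mono exp_ge_add_one_self)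
  then show ?thesis
    unfolding avg_add 0 using I by (simp add: avg_const finite_signs signs_nonempty)
qed

text \<open>
  Averaged over the signs of the interactions, the weight of each single configuration factorizes,
  because \<open>chi S x\<close> is then only a fixed sign.
\<close>

lemma avg_mean_weight:
  fixes \<delta> :: real
  assumes I: "finite I" "J \<subseteq> Pow I"
  shows "avg (signs J) (mean_weight I J \<delta>) \<le> exp (card J * \<delta>\<^sup>2 / 2)"
proof -
  have J: "finite J" using I by (meson finite_Pow_iff finite_subset)
  have "avg (signs J) (mean_weight I J \<delta>)
     = avg (signs I) (\<lambda>x. avg (signs J) (\<lambda>s. exp (\<Sum>S\<in>J. s S * (\<delta> * chi S x))))"
    unfolding mean_weight_def energy_def by (subst avg_swap) (simp add: mult_ac)
  also have "\<dots> \<le> avg (signs I) (\<lambda>x. exp (card J * \<delta>\<^sup>2 / 2))"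
  proof (rule avg_mono)
    fix x assume x: "x \<in> signs I"
    have "(\<Sum>S\<in>J. (\<delta> * chi S x)\<^sup>2) = card J * \<delta>\<^sup>2"
      using chi_square[OF I(1) _ x] I(2) by (simp add: power_mult_distrib subset_iff)
    then show "avg (signs J) (\<lambda>s. exp (\<Sum>S\<in>J. s S * (\<delta> * chi S x))) \<le> exp (card J * \<delta>\<^sup>2 / 2)"
      using rademacher_exp_moment[OF J, of "\<lambda>S. \<delta> * chi S x"] by simp
  qed
  finally show ?thesis using I by (simp add: avg_const finite_signs signs_nonempty)
qed

text \<open>
  Markov's inequality for the nonnegative quantity \<open>mean_weight I J \<delta> s - 1\<close>.
\<close>

lemma few_large_weights:
  fixes \<delta> :: real
  assumes I: "finite I" "J \<subseteq> Pow I" "{} \<notin> J" and small: "card J * \<delta>\<^sup>2 \<le> 1 / 900"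
  shows "16 * card (signs J - {s \<in> signs J. mean_weight I J \<delta> s \<le> 2}) \<le> card (signs J)"
proof -
  have J: "finite J" using I by (meson finite_Pow_iff finite_subset)
  let ?B = "signs J - {s \<in> signs J. mean_weight I J \<delta> s \<le> 2}"
  have fin: "finite (signs J)" using J by (rule finite_signs)
  have N: "0 < card (signs J)" using fin signs_nonempty by (simp add: card_gt_0_iff)
  have "card ?B / card (signs J) = avg (signs J) (\<lambda>s. if s \<in> ?B then 1 else 0)"
    by (rule avg_indicator[symmetric, OF fin]) blast
  also have "\<dots> \<le> avg (signs J) (\<lambda>s. mean_weight I J \<delta> s - 1)"
  proof (rule avg_mono)
    fix s assume s: "s \<in> signs J"
    show "(if s \<in> ?B then 1 else 0) \<le> mean_weight I J \<delta> s - 1"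
      using mean_weight_ge_1[OF I, of \<delta> s] s by auto
  qed
  also have "\<dots> = avg (signs J) (mean_weight I J \<delta>) - 1"
    using fin by (simp add: avg_diff avg_const signs_nonempty)
  also have "\<dots> \<le> exp (card J * \<delta>\<^sup>2 / 2) - 1" using avg_mean_weight[OF I(1,2)] by simp
  also have "\<dots> \<le> 2 * (card J * \<delta>\<^sup>2 / 2)"
    using exp_bound_lemma[of "card J * \<delta>\<^sup>2 / 2"] small by simp
  also have "\<dots> \<le> 1 / 16" using small by simp
  finally show ?thesis using N by (simp add: field_simps)
qed

lemma abs_exp_diff_ge:
  fixes a b m :: real
  assumes "m \<le> exp a" "m \<le> exp b" "0 \<le> m"
  shows "m * \<bar>a - b\<bar> \<le> \<bar>exp a - exp b\<bar>"
proof -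
  have main: "m * (d - c) \<le> exp d - exp c" if "m \<le> exp c" "c \<le> d" for c d
  proof -
    have "m * (d - c) \<le> exp c * (d - c)" using that by (intro mult_right_mono) auto
    also have "\<dots> \<le> exp c * (exp (d - c) - 1)"
      using exp_ge_add_one_self[of "d - c"] by (intro mult_left_mono) (linarith, simp)
    also have "\<dots> = exp d - exp c" by (simp add: exp_diff right_diff_distrib)
    finally show ?thesis .
  qed
  show ?thesis using main[of a b] main[of b a] assms by (cases "a \<le> b") auto
qed

text \<open>
  Where both energies are at most 1 in absolute value, both densities relative to the uniform
  distribution are at least \<open>exp (- 1) / 2 \<ge> 1 / 6\<close>, so there the difference of the densities dominates
  the difference \<open>W\<close> of their logarithms. By Chebyshev's inequality the excluded set \<open>P\<close> is small. The function
  \<open>W\<close> is a polynomial of degree two whose constant term comes from the normalizing sums; by Parseval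
  this term can only increase the second moment, which is at least \<open>4 * \<delta>\<^sup>2\<close> for each differing sign.
\<close>

lemma gibbs_separation:
  fixes \<delta> :: real
  assumes I: "finite I" and J: "J \<subseteq> {S. S \<subseteq> I \<and> S \<noteq> {} \<and> card S \<le> 2}"
    and sr: "s \<in> signs J" "r \<in> signs J" "mean_weight I J \<delta> s \<le> 2" "mean_weight I J \<delta> r \<le> 2"
    and \<delta>: "0 \<le> \<delta>" "card J * \<delta>\<^sup>2 \<le> 1 / 900"
  shows "\<delta> * sqrt (hamming J s r) / 168
    \<le> tv_dist (signs I) (pmf (gibbs_pmf (signs I) (energy J \<delta> s))) (pmf (gibbs_pmf (signs I) (energy J \<delta> r)))"
proof -
  let ?X = "signs I"
  let ?E = "avg ?X"
  have JI: "J \<subseteq> Pow I" "{} \<notin> J" using J by auto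
  have finJ: "finite J" using JI I by (meson finite_Pow_iff finite_subset)
  have X: "finite ?X" "?X \<noteq> {}" using I by (simp_all add: finite_signs signs_nonempty)
  define U where "U t x = energy J \<delta> t x - ln (mean_weight I J \<delta> t)" for t x
  define W where "W x = U s x - U r x" for x
  define P where "P x \<longleftrightarrow> 1 < \<bar>energy J \<delta> s x\<bar> \<or> 1 < \<bar>energy J \<delta> r x\<bar>" for x
  define a where "a S = (if S \<in> J then \<delta> * (s S - r S)
      else if S = {} then ln (mean_weight I J \<delta> r) - ln (mean_weight I J \<delta> s) else 0)" for S
  have W_poly: "W x = (\<Sum>S\<in>low_sets I 2. a S * chi S x)" for x
  proof -
    have fin: "finite (low_sets I 2)" using I by (simp add: low_sets_def)
    have sub: "insert {} J \<subseteq> low_sets I 2" using J by (auto simp: low_sets_def)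
    have "(\<Sum>S\<in>low_sets I 2. a S * chi S x) = (\<Sum>S\<in>insert {} J. a S * chi S x)"
      using fin sub by (intro sum.mono_neutral_right) (auto simp: a_def)
    also have "\<dots> = (ln (mean_weight I J \<delta> r) - ln (mean_weight I J \<delta> s)) + (\<Sum>S\<in>J. \<delta> * (s S - r S) * chi S x)"
      using JI(2) finJ by (simp add: a_def chi_def)
    also have "(\<Sum>S\<in>J. \<delta> * (s S - r S) * chi S x) = energy J \<delta> s x - energy J \<delta> r x"
      unfolding energy_def sum_subtractf[symmetric] by (intro sum.cong) (auto simp: algebra_simps)
    also have "(ln (mean_weight I J \<delta> r) - ln (mean_weight I J \<delta> s)) + \<dots> = W x"
      by (simp add: W_def U_def)
    finally show ?thesis by simp
  qed
  have W2: "4 * \<delta>\<^sup>2 * hamming J s r \<le> ?E (\<lambda>x. (W x)\<^sup>2)"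
  proof -
    have "4 * \<delta>\<^sup>2 * hamming J s r = (\<Sum>S\<in>J. (a S)\<^sup>2)"
      unfolding hamming_eq_sum[OF finJ] sum_distrib_left
    proof (rule sum.cong)
      fix S assume S: "S \<in> J"
      show "4 * \<delta>\<^sup>2 * (if s S \<noteq> r S then 1 else 0) = (a S)\<^sup>2"
        using signsD[OF sr(1) S] signsD[OF sr(2) S] S by (auto simp: a_def power_mult_distrib)
    qed simp
    also have "\<dots> \<le> (\<Sum>S\<in>low_sets I 2. (a S)\<^sup>2)"
      using I J by (intro sum_mono2) (auto simp: low_sets_def)
    also have "\<dots> = ?E (\<lambda>x. (W x)\<^sup>2)"
      unfolding W_poly using I by (intro parseval[symmetric]) (auto simp: low_sets_def)
    finally show ?thesis .
  qed
  have m4: "?E (\<lambda>x. W x ^ 4) \<le> 81 * (?E (\<lambda>x. (W x)\<^sup>2))\<^sup>2"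
    using bonami[OF I, where q = 2 and a = a] unfolding W_poly by simp
  have bad: "?E (\<lambda>x. if P x then 1 else 0) \<le> 1 / 324"
  proof -
    have "?E (\<lambda>x. if P x then 1 else 0) \<le> ?E (\<lambda>x. (energy J \<delta> s x)\<^sup>2 + (energy J \<delta> r x)\<^sup>2)"
    proof (rule avg_mono)
      fix x
      have "1 \<le> y\<^sup>2" if "1 < \<bar>y\<bar>" for y :: real using that by (simp add: abs_square_less_1 not_less[symmetric])
      then show "(if P x then 1 else 0) \<le> (energy J \<delta> s x)\<^sup>2 + (energy J \<delta> r x)\<^sup>2"
        unfolding P_def by (auto intro: add_increasing add_increasing2)
    qed
    also have "\<dots> = 2 * (card J * \<delta>\<^sup>2)"
      using avg_energy_square[OF I JI(1)] sr by (simp add: avg_add)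
    finally show ?thesis using \<delta> by simp
  qed
  have pt: "1/6 * (if P x then 0 else \<bar>W x\<bar>) \<le> \<bar>exp (U s x) - exp (U r x)\<bar>" for x
  proof (cases "P x")
    case False
    have "1 / 6 \<le> exp (U t x)" if "\<bar>energy J \<delta> t x\<bar> \<le> 1" "mean_weight I J \<delta> t \<le> 2" for t
    proof -
      have Z: "1 \<le> mean_weight I J \<delta> t" by (rule mean_weight_ge_1[OF I JI])
      have "1 / 6 = (1 / 3) / (2::real)" by simp
      also have "\<dots> \<le> exp (- 1) / 2"
        using exp_le by (simp add: exp_minus field_simps)
      also have "\<dots> \<le> exp (energy J \<delta> t x) / mean_weight I J \<delta> t"
        using that Z by (intro frac_le) auto
      also have "\<dots> = exp (U t x)" using Z by (simp add: U_def exp_diff)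
      finally show ?thesis .
    qed
    then have "1/6 * \<bar>U s x - U r x\<bar> \<le> \<bar>exp (U s x) - exp (U r x)\<bar>"
      using False sr by (intro abs_exp_diff_ge) (auto simp: P_def not_less)
    then show ?thesis using False by (simp add: W_def)
  qed simp
  have "\<delta> * sqrt (hamming J s r) / 168 = 1/12 * (sqrt (4 * \<delta>\<^sup>2 * hamming J s r) / 28)"
    using \<delta> by (simp add: real_sqrt_mult)
  also have "\<dots> \<le> 1/12 * (sqrt (?E (\<lambda>x. (W x)\<^sup>2)) / 28)"
    using W2 by simp
  also have "\<dots> \<le> 1/12 * ?E (\<lambda>x. if P x then 0 else \<bar>W x\<bar>)"
    by (intro mult_left_mono truncated_L1_lower_bound[OF X m4 bad]) simp
  also have "\<dots> = 1/2 * ?E (\<lambda>x. 1/6 * (if P x then 0 else \<bar>W x\<bar>))"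
    by (simp only: avg_cmult)
  also have "\<dots> \<le> 1/2 * ?E (\<lambda>x. \<bar>exp (U s x) - exp (U r x)\<bar>)"
    by (intro mult_left_mono avg_mono pt) simp
  also have "\<dots> = tv_dist ?X (pmf (gibbs_pmf ?X (energy J \<delta> s))) (pmf (gibbs_pmf ?X (energy J \<delta> r)))"
    unfolding tv_dist_def avg_def sum_divide_distrib
    using X by (intro arg_cong2[where f = "(*)"] sum.cong refl)
      (simp add: pmf_gibbs_energy[OF I] U_def[symmetric] diff_divide_distrib[symmetric])
  finally show ?thesis .
qed

text \<open>
  Flipping one sign changes the energy by at most \<open>2 * \<delta>\<close> everywhere, hence the logarithm of the
  normalizing sum by at most \<open>2 * \<delta>\<close> and the log-density by at most \<open>4 * \<delta>\<close>. For every sign vector,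
  good or bad, the affinity of one sample is therefore at least \<open>1 - 8 * \<delta>\<^sup>2\<close>, and that of \<open>n\<close> samples is
  at least \<open>1 - 8 * n * \<delta>\<^sup>2\<close>.
\<close>

lemma gibbs_close:
  fixes \<delta> :: real
  assumes I: "finite I" and J: "J \<subseteq> {S. S \<subseteq> I \<and> S \<noteq> {} \<and> card S \<le> 2}"
    and s: "s \<in> signs J" and S: "S \<in> J" and \<delta>: "0 \<le> \<delta>" "n * \<delta>\<^sup>2 \<le> 1 / 900" and n: "n \<ge> 1"
  shows "1 / 4 \<le> (\<Sum>x\<in>samples (signs I) n.
      min (likelihood (pmf (gibbs_pmf (signs I) (energy J \<delta> s))) n x)
          (likelihood (pmf (gibbs_pmf (signs I) (energy J \<delta> (flip S s)))) n x))"
proof -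
  let ?X = "signs I" and ?r = "flip S s"
  let ?p = "pmf (gibbs_pmf ?X (energy J \<delta> s))" and ?q = "pmf (gibbs_pmf ?X (energy J \<delta> ?r))"
  have X: "finite ?X" "?X \<noteq> {}" using I by (simp_all add: finite_signs signs_nonempty)
  have "J \<subseteq> Pow I" using J by auto
  then have finJ: "finite J" using I by (meson finite_Pow_iff finite_subset)
  have one: "(\<Sum>x\<in>?X. pmf (gibbs_pmf ?X T) x) = 1" for T
    using X by (intro sum_pmf_eq_1) (auto simp: set_gibbs)
  have diff: "\<bar>energy J \<delta> ?r x - energy J \<delta> s x\<bar> \<le> 2 * \<delta>" if x: "x \<in> ?X" for x
  proof -
    have "energy J \<delta> ?r x - energy J \<delta> s x = (\<Sum>T\<in>J. if T = S then - 2 * \<delta> * s S * chi S x else 0)"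
      unfolding energy_def sum_subtractf[symmetric] by (intro sum.cong) (auto simp: flip_def)
    also have "\<dots> = - 2 * \<delta> * s S * chi S x" using finJ S by simp
    also have "\<bar>\<dots>\<bar> = 2 * \<delta> * \<bar>s S\<bar> * \<bar>chi S x\<bar>" using \<delta> by (simp add: abs_mult)
    also have "\<dots> = 2 * \<delta>" using signsD[OF s S] abs_chi[OF I _ x, of S] S J by auto
    finally show ?thesis by simp
  qed
  have Z0: "1 \<le> mean_weight I J \<delta> t" for t by (rule mean_weight_ge_1) (use I J in auto)
  have Zle: "mean_weight I J \<delta> t \<le> exp (2 * \<delta>) * mean_weight I J \<delta> t'"
    if "\<And>x. x \<in> ?X \<Longrightarrow> energy J \<delta> t x \<le> 2 * \<delta> + energy J \<delta> t' x" for t t'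
    unfolding mean_weight_def avg_cmult[symmetric] exp_add[symmetric]
    by (rule avg_mono) (simp add: that)
  have lnZ: "ln (mean_weight I J \<delta> t) \<le> 2 * \<delta> + ln (mean_weight I J \<delta> t')"
    if "mean_weight I J \<delta> t \<le> exp (2 * \<delta>) * mean_weight I J \<delta> t'" for t t'
  proof -
    have pos: "0 < mean_weight I J \<delta> t" "0 < mean_weight I J \<delta> t'" using Z0[of t] Z0[of t'] by linarith+
    have "ln (mean_weight I J \<delta> t) \<le> ln (exp (2 * \<delta>) * mean_weight I J \<delta> t')"
      using that pos by (intro ln_mono) auto
    also have "\<dots> = 2 * \<delta> + ln (mean_weight I J \<delta> t')" using pos by (simp add: ln_mult)
    finally show ?thesis .
  qed
  define u where "u x = (energy J \<delta> ?r x - energy J \<delta> s x)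
      - (ln (mean_weight I J \<delta> ?r) - ln (mean_weight I J \<delta> s))" for x
  have u: "\<bar>u x\<bar> \<le> 4 * \<delta>" if x: "x \<in> ?X" for x
  proof -
    have 1: "energy J \<delta> ?r y \<le> 2 * \<delta> + energy J \<delta> s y" "energy J \<delta> s y \<le> 2 * \<delta> + energy J \<delta> ?r y"
      if "y \<in> ?X" for y using diff[OF that] by linarith+
    from lnZ[OF Zle[OF 1(1)]] lnZ[OF Zle[OF 1(2)]] diff[OF x]
    show ?thesis unfolding u_def by linarith
  qed
  have q: "?q x = ?p x * exp (u x)" if "x \<in> ?X" for x
    using that by (simp add: pmf_gibbs_energy[OF I] exp_add[symmetric] u_def)
  have d1: "1 * \<delta>\<^sup>2 \<le> n * \<delta>\<^sup>2" using n by (intro mult_right_mono) auto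
  then have "\<delta>\<^sup>2 \<le> (1 / 30)\<^sup>2" using \<delta> by (simp add: power2_eq_square)
  then have d2: "\<delta> \<le> 1 / 30" by (rule power2_le_imp_le) simp
  have \<rho>: "1 - (4 * \<delta>)\<^sup>2 / 2 \<le> (\<Sum>x\<in>?X. sqrt (?p x * ?q x))"
    by (rule hellinger_affinity_bound[OF X(1) _ one one q u]) (use d2 in auto)
  have "3 / 4 \<le> 1 + real n * (- (4 * \<delta>)\<^sup>2 / 2)"
    using \<delta>(2) by (simp add: power_mult_distrib)
  also have "\<dots> \<le> (1 + (- (4 * \<delta>)\<^sup>2 / 2)) ^ n"
    using d1 \<delta> by (intro Bernoulli_inequality) (simp add: power_mult_distrib)
  also have "\<dots> \<le> (\<Sum>x\<in>?X. sqrt (?p x * ?q x)) ^ n"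
    using \<rho> d1 \<delta> by (intro power_mono) (auto simp: power_mult_distrib)
  also have "\<dots> - 1 / 2 \<le> (\<Sum>x\<in>samples ?X n. min (likelihood ?p n x) (likelihood ?q n x))"
    by (rule hellinger_two_point[OF X(1) _ one _ one]) auto
  finally show ?thesis by simp
qed

text \<open>
  Assouad's lemma with interactions \<open>\<plusminus> \<delta>\<close>. It needs a separation linear in the Hamming distance \<open>h\<close>,
  and \<open>sqrt h \<ge> h / sqrt k\<close> since \<open>h \<le> k\<close>; this loses only a constant because a typical \<open>h\<close> is of order
  \<open>k\<close>.
\<close>

theorem minimax_spin_family_lower:
  assumes I: "finite I" and J: "J \<subseteq> {S. S \<subseteq> I \<and> S \<noteq> {} \<and> card S \<le> 2}" and n: "n \<ge> 1"
  shows "ennreal (1 / 161280 * min 1 (sqrt (card J / n)))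
    \<le> minimax_rate (signs I) n (exp_family (signs I) J chi)"
proof (cases "J = {}")
  case False
  have JI: "J \<subseteq> Pow I" "{} \<notin> J" using J by auto
  have finJ: "finite J" using JI I by (meson finite_Pow_iff finite_subset)
  have X: "finite (signs I)" "signs I \<noteq> {}" using I by (simp_all add: finite_signs signs_nonempty)
  define k where "k = card J"
  have k: "0 < k" using False finJ by (simp add: k_def card_gt_0_iff)
  \<comment> \<open>\<open>\<delta>\<close> must be below \<open>1 / sqrt n\<close> for indistinguishability and below \<open>1 / sqrt k\<close> for bounded weights\<close>
  define M where "M = real (max n k)"
  have M: "0 < M" "real n \<le> M" "real k \<le> M" using k by (simp_all add: M_def)
  define \<delta> where "\<delta> = 1 / (30 * sqrt M)"
  have \<delta>: "0 < \<delta>" "\<delta>\<^sup>2 = 1 / (900 * M)" using M by (simp_all add: \<delta>_def power_divide power_mult_distrib)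
  have nk: "n * \<delta>\<^sup>2 \<le> 1 / 900" "card J * \<delta>\<^sup>2 \<le> 1 / 900"
    using M by (simp_all add: \<delta> k_def[symmetric] field_simps)
  define \<kappa> where "\<kappa> = \<delta> / (168 * sqrt k)"
  let ?p = "\<lambda>s. gibbs_pmf (signs I) (energy J \<delta> s)"
  let ?G = "{s \<in> signs J. mean_weight I J \<delta> s \<le> 2}"
  have "ennreal (\<kappa> * card J / 32) \<le> minimax_rate (signs I) n (exp_family (signs I) J chi)"
  proof (rule assouad[where p = ?p and G = ?G])
    show "set_pmf f \<subseteq> signs I" if "f \<in> exp_family (signs I) J chi" for f
      using that by (auto simp: exp_family_def set_gibbs[OF X])
    show "?p s \<in> exp_family (signs I) J chi" for s
      unfolding exp_family_def energy_def[abs_def] by (intro CollectI exI[of _ "\<lambda>S. \<delta> * s S"]) simp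
    show "16 * card (signs J - ?G) \<le> card (signs J)"
      by (rule few_large_weights[OF I JI nk(2)])
    show "\<kappa> * hamming J s r \<le> tv_dist (signs I) (pmf (?p s)) (pmf (?p r))" if "s \<in> ?G" "r \<in> ?G" for s r
    proof -
      let ?h = "real (hamming J s r)"
      have "sqrt ?h \<le> sqrt k" using hamming_le[OF finJ, of s r] by (simp add: k_def)
      then have "sqrt ?h * sqrt ?h \<le> sqrt k * sqrt ?h" by (intro mult_right_mono) auto
      then have "?h / sqrt k \<le> sqrt ?h" using k by (simp add: field_simps)
      then have "\<delta> / 168 * (?h / sqrt k) \<le> \<delta> / 168 * sqrt ?h" using \<delta> by (intro mult_left_mono) auto
      then have "\<kappa> * ?h \<le> \<delta> * sqrt ?h / 168" by (simp add: \<kappa>_def)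
      also have "\<dots> \<le> tv_dist (signs I) (pmf (?p s)) (pmf (?p r))"
        using that \<delta> nk by (intro gibbs_separation[OF I J]) auto
      finally show ?thesis .
    qed
    show "1 / 4 \<le> (\<Sum>x\<in>samples (signs I) n.
        min (likelihood (pmf (?p s)) n x) (likelihood (pmf (?p (flip S s))) n x))"
      if "s \<in> signs J" "S \<in> J" for s S
      using that \<delta> nk n by (intro gibbs_close[OF I J]) auto
  qed (use X finJ \<delta> in \<open>auto simp: \<kappa>_def\<close>)
  also have "\<kappa> * card J / 32 = 1 / 161280 * sqrt (k / M)"
  proof -
    have "real k = sqrt k * sqrt k" by simp
    then have "\<kappa> * k = \<delta> * sqrt k / 168" using k by (simp add: \<kappa>_def field_simps)
    then show ?thesis by (simp add: k_def[symmetric] \<delta>_def real_sqrt_divide)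
  qed
  also have "sqrt (k / M) = min 1 (sqrt (card J / n))"
  proof (cases "n \<le> k")
    case True
    then show ?thesis using k n by (simp add: M_def max_def k_def[symmetric] min_def)
  next
    case False
    then have "sqrt (k / n) \<le> 1" using n by simp
    with False show ?thesis by (simp add: M_def k_def[symmetric] min_def)
  qed
  finally show ?thesis .
qed simp

section \<open>Ising models as exponential families\<close>

lemma spin_cube_eq_signs: "spin_cube d = signs {1..d}"
  by (simp add: spin_cube_def signs_def)

lemma ising_pmf_eq_gibbs:
  "ising_pmf d E w h = gibbs_pmf (spin_cube d)
     (\<lambda>x. (\<Sum>e\<in>E. w e * chi e x) + (\<Sum>i=1..d. h i * x i))"
  by (simp add: ising_pmf_def gibbs_pmf_def ising_weight_def chi_def cong: if_cong)

lemma ising_class_no_field_eq: "ising_class_no_field d E = exp_family (spin_cube d) E chi"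
  by (simp add: ising_class_no_field_def exp_family_def ising_pmf_eq_gibbs)

text \<open>
  The field at \<open>i\<close> is regarded as the interaction on \<open>{i}\<close>.
\<close>

definition interactions_and_fields :: "nat \<Rightarrow> nat set set \<Rightarrow> nat set set" where
  "interactions_and_fields d E = E \<union> (\<lambda>i. {i}) ` {1..d}"

lemma finite_simple_graph: "simple_graph d E \<Longrightarrow> finite E"
  unfolding simple_graph_def by (rule finite_subset[of _ "Pow {1..d}"]) auto

lemma graph_disjoint_singletons:
  assumes "simple_graph d E"
  shows "E \<inter> (\<lambda>i. {i}) ` {1..d} = {}"
proof -
  have "card e = 2" if "e \<in> E" for e using that assms by (auto simp: simple_graph_def)
  then show ?thesis by fastforce
qed

lemma card_interactions_and_fields:
  assumes "simple_graph d E"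
  shows "card (interactions_and_fields d E) = card E + d"
proof -
  have "card (interactions_and_fields d E) = card E + card ((\<lambda>i. {i}) ` {1..d})"
    unfolding interactions_and_fields_def
    by (intro card_Un_disjoint finite_simple_graph[OF assms] graph_disjoint_singletons[OF assms]) simp
  then show ?thesis by (simp add: card_image)
qed

lemma ising_class_eq:
  assumes G: "simple_graph d E"
  shows "ising_class d E = exp_family (spin_cube d) (interactions_and_fields d E) chi"
proof -
  have split: "(\<Sum>S\<in>interactions_and_fields d E. \<theta> S * chi S x)
      = (\<Sum>e\<in>E. \<theta> e * chi e x) + (\<Sum>i=1..d. \<theta> {i} * x i)" for \<theta> x
    unfolding interactions_and_fields_def
    by (subst sum.union_disjoint[OF finite_simple_graph[OF G] _ graph_disjoint_singletons[OF G]])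
       (simp_all add: sum.reindex chi_def)
  show ?thesis
  proof (intro set_eqI iffI)
    fix f assume "f \<in> ising_class d E"
    then obtain w h where f: "f = ising_pmf d E w h" by (auto simp: ising_class_def)
    define \<theta> where "\<theta> S = (if S \<in> E then w S else h (the_elem S))" for S
    have "{i} \<notin> E" if "i \<in> {1..d}" for i using graph_disjoint_singletons[OF G] that by auto
    then have "f = gibbs_pmf (spin_cube d) (\<lambda>x. \<Sum>S\<in>interactions_and_fields d E. \<theta> S * chi S x)"
      unfolding f ising_pmf_eq_gibbs split by (simp add: \<theta>_def)
    then show "f \<in> exp_family (spin_cube d) (interactions_and_fields d E) chi"
      by (auto simp: exp_family_def)
  next
    fix f assume "f \<in> exp_family (spin_cube d) (interactions_and_fields d E) chi"
    then obtain \<theta> where "f = ising_pmf d E \<theta> (\<lambda>i. \<theta> {i})"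
      by (auto simp: exp_family_def split ising_pmf_eq_gibbs)
    then show "f \<in> ising_class d E" by (auto simp: ising_class_def)
  qed
qed

lemma minimax_spin_family:
  assumes J: "J \<subseteq> {S. S \<subseteq> {1..d} \<and> S \<noteq> {} \<and> card S \<le> 2}" and n: "n \<ge> 1"
  shows "ennreal (1 / 161280 * min 1 (sqrt (real (card J) / real n)))
      \<le> minimax_rate (spin_cube d) n (exp_family (spin_cube d) J chi)"
    and "minimax_rate (spin_cube d) n (exp_family (spin_cube d) J chi)
      \<le> ennreal (218 * min 1 (sqrt (real (card J) / real n)))"
proof -
  have "finite J" using J by (rule finite_subset) simp
  then show "minimax_rate (spin_cube d) n (exp_family (spin_cube d) J chi)
      \<le> ennreal (218 * min 1 (sqrt (real (card J) / real n)))"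
    by (intro minimax_exp_family_upper finite_spin_cube spin_cube_nonempty n)
  show "ennreal (1 / 161280 * min 1 (sqrt (real (card J) / real n)))
      \<le> minimax_rate (spin_cube d) n (exp_family (spin_cube d) J chi)"
    unfolding spin_cube_eq_signs by (rule minimax_spin_family_lower[OF _ J n]) simp
qed

theorem theorem1p3:
  shows "\<exists>c C :: real. c > 0 \<and> C > 0 \<and>
    (\<forall>(d::nat) (n::nat) (E :: nat set set). d \<ge> 1 \<longrightarrow> n \<ge> 1 \<longrightarrow> simple_graph d E \<longrightarrow>
      (ennreal (c * min 1 (sqrt (real (card E + d) / real n)))
          \<le> minimax_rate (spin_cube d) n (ising_class d E) \<and>
       minimax_rate (spin_cube d) n (ising_class d E)
          \<le> ennreal (C * min 1 (sqrt (real (card E + d) / real n)))) \<and>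
      (ennreal (c * min 1 (sqrt (real (card E) / real n)))
          \<le> minimax_rate (spin_cube d) n (ising_class_no_field d E) \<and>
       minimax_rate (spin_cube d) n (ising_class_no_field d E)
          \<le> ennreal (C * min 1 (sqrt (real (card E) / real n)))))"
proof (rule exI[of _ "1 / 161280 :: real"], rule exI[of _ "218 :: real"], intro conjI allI impI)
  fix d n :: nat and E :: "nat set set"
  assume n: "n \<ge> 1" and G: "simple_graph d E"
  have E: "E \<subseteq> {S. S \<subseteq> {1..d} \<and> S \<noteq> {} \<and> card S \<le> 2}"
    using G by (auto simp: simple_graph_def)
  then have EF: "interactions_and_fields d E \<subseteq> {S. S \<subseteq> {1..d} \<and> S \<noteq> {} \<and> card S \<le> 2}"
    by (auto simp: interactions_and_fields_def)
  note full = minimax_spin_family[OF EF n, folded ising_class_eq[OF G],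
      unfolded card_interactions_and_fields[OF G]]
  note no_field = minimax_spin_family[OF E n, folded ising_class_no_field_eq]
  show "ennreal (1 / 161280 * min 1 (sqrt (real (card E + d) / real n)))
          \<le> minimax_rate (spin_cube d) n (ising_class d E)" by (rule full(1))
  show "minimax_rate (spin_cube d) n (ising_class d E)
          \<le> ennreal (218 * min 1 (sqrt (real (card E + d) / real n)))" by (rule full(2))
  show "ennreal (1 / 161280 * min 1 (sqrt (real (card E) / real n)))
          \<le> minimax_rate (spin_cube d) n (ising_class_no_field d E)" by (rule no_field(1))
  show "minimax_rate (spin_cube d) n (ising_class_no_field d E)
          \<le> ennreal (218 * min 1 (sqrt (real (card E) / real n)))" by (rule no_field(2))
qed simp_all

end
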